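(* Let $\{s_k\}_{k\in\mathbb{N}_0}$ be a positive sequence, let $d\in\mathbb{N}$ (so $d\ge 1$) and $\ell_0\in 2\mathbb{N}_0$, and let $\{\tilde s_k\}_{k\in\mathbb{N}_0}$ be given by $\tilde s_k=s_{kd+\ell_0}$. If $\{s_k\}$ is indeterminate, then $\{\tilde s_k\}$ is indeterminate. Equivalently, if $\{\tilde s_k\}$ is determinate, then $\{s_k\}$ is determinate.
   Context: A sequence of real numbers $\{s_k\}_{k\in\mathbb{N}_0}$ is called positive if for every $n$ the Hankel matrix $(s_{i+j})_{i,j=0}^n$ is positive semidefinite; equivalently there exists a non-decreasing function $\sigma$ on $\mathbb{R}$ (a moment solution) with $s_k=\int_{-\infty}^\infty x^k\,d\sigma(x)$ for all $k\in\mathbb{N}_0$. Two non-decreasing functions are not considered distinct if their difference is constant at all points of continuity of the difference. A positive sequence is determinate if it has exactly one moment solution (in this sense), and indeterminate otherwise. (It is known, by a theorem of Berg–Chen–Ismail, that a positive sequence is determinate iff the smallest eigenvalue of $(s_{i+j})_{i,j=0}^n$ tends to $0$ as $n\to\infty$.) *)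

theory Defs
  imports "HOL-Analysis.Analysis"
begin

definition positive_seq :: "(nat \<Rightarrow> real) \<Rightarrow> bool" where
  "positive_seq s \<longleftrightarrow>
     (\<forall>n::nat. \<forall>c::nat \<Rightarrow> real. 0 \<le> (\<Sum>i\<le>n. \<Sum>j\<le>n. c i * c j * s (i + j)))"

definition moment_solution :: "(nat \<Rightarrow> real) \<Rightarrow> real measure \<Rightarrow> bool" where
  "moment_solution s M \<longleftrightarrow>
     sets M = sets borel \<and> finite_measure M \<and>
     (\<forall>k::nat. integrable M (\<lambda>x. x ^ k) \<and> (\<integral>x. x ^ k \<partial>M) = s k)"

definition determinate :: "(nat \<Rightarrow> real) \<Rightarrow> bool" where
  "determinate s \<longleftrightarrow> positive_seq s \<and>
     (\<forall>M N. moment_solution s M \<and> moment_solution s N \<longrightarrow> M = N)"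

definition indeterminate :: "(nat \<Rightarrow> real) \<Rightarrow> bool" where
  "indeterminate s \<longleftrightarrow> positive_seq s \<and> \<not> determinate s"

end

theory Submission
  imports Defs "HOL-Probability.Probability" "HOL-Computational_Algebra.Fundamental_Theorem_Algebra"
begin

text \<open>
  Two distinct solutions stay distinct when multiplied by \<open>x ^ l\<close> with \<open>l\<close> even (they have equal
  mass, so they cannot differ only at 0) and when pushed forward under an odd power. This
  reduces the theorem to passing from \<open>s k\<close> to \<open>s (2 * k)\<close>. If two distinct solutions have the same
  image \<open>\<mu>\<close> under squaring, then the images of their restrictions to the positive half-line have
  densities \<open>g\<close> and \<open>h\<close> with respect to \<open>\<mu>\<close>, and equality of the odd moments says that
  \<open>f y = (g y - h y) * sqrt y\<close>, a nonzero element of \<open>L\<^sup>2(\<mu>)\<close>, is orthogonal to all polynomials.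

  The Cauchy transform \<open>F\<close> of \<open>f \<mu>\<close> is nonzero at some nonreal \<open>z\<close>. Since
  \<open>p z * F z = \<integral> p f / (x - z) d\<mu>\<close> for every polynomial \<open>p\<close>, evaluation at \<open>z\<close> is bounded for the
  norm of \<open>L\<^sup>2(\<mu> / |x - z|\<^sup>2)\<close>. Hence for small \<open>\<epsilon> > 0\<close> the functional
  \<open>q \<mapsto> \<integral> q / |x - z|\<^sup>2 d\<mu> - \<epsilon> Re (q z)\<close> is still nonnegative on squares, and by Hamburger's theorem
  it is represented by a measure \<open>\<rho>\<close>. The measure \<open>|x - z|\<^sup>2 \<rho>\<close> has the moments of \<open>\<mu>\<close>, because
  \<open>|x - z|\<^sup>2\<close> vanishes at \<open>z\<close> as a polynomial in \<open>x\<close>, but it differs from \<open>\<mu>\<close>.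
\<close>

section \<open>Nonnegative real polynomials\<close>

text \<open>Off the finitely many roots of \<open>q\<close> the value \<open>poly q x\<close> is
  strictly positive, so the sign passes to \<open>r\<close>; at a root of \<open>q\<close> it
  follows by continuity.\<close>

lemma nonneg_poly_cofactor:
  fixes q r :: "real poly"
  assumes "\<And>x. 0 \<le> poly (q * r) x" and "\<And>x. 0 \<le> poly q x" and "q \<noteq> 0"
  shows "0 \<le> poly r a"
proof -
  have "finite {x. poly q x = 0}"
    using assms(3) by (rule poly_roots_finite)
  then have "eventually (\<lambda>x. x \<notin> {x. poly q x = 0}) (at a)"
    using islimpt_finite[of "{x. poly q x = 0}" a]
    by (simp add: islimpt_iff_eventually)
  then have ev: "eventually (\<lambda>x. 0 \<le> poly r x) (at a)"
  proof eventually_elim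
    case (elim x)
    then have "0 < poly q x" using assms(2)[of x] by (simp add: less_le)
    moreover have "0 \<le> poly q x * poly r x" using assms(1)[of x] by simp
    ultimately show ?case by (simp add: zero_le_mult_iff)
  qed
  have "(poly r \<longlongrightarrow> poly r a) (at a)"
    using poly_isCont[of a r] by (simp add: isCont_def)
  then show ?thesis
    using ev by (rule tendsto_lowerbound) simp
qed

text \<open>Multiplicativity of the squared modulus of a + ib and c + id.\<close>

lemma sum_two_squares_mult:
  fixes p q :: "'a::comm_ring_1"
  assumes "p = a^2 + b^2" "q = c^2 + d^2"
  shows "p * q = (a*c - b*d)^2 + (a*d + b*c)^2"
  using assms by (simp add: power2_eq_square algebra_simps)

text \<open>Strong induction on the degree. A complex root yields a real factor that is itself a sum
  of two squares: the square of a linear polynomial for a real root, (X - Re w)^2 + (Im w)^2 for a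
  conjugate pair.\<close>

lemma nonneg_poly_sum_two_squares:
  fixes p :: "real poly"
  assumes "\<And>x. 0 \<le> poly p x"
  shows "\<exists>u v. p = u^2 + v^2"
  using assms
proof (induction "degree p" arbitrary: p rule: less_induct)
  case less
  \<comment> \<open>Shared induction step: a sum of two squares of positive degree can be split off,
    as the cofactor is again nonnegative and of smaller degree.\<close>
  have factor: "\<exists>u v. p = u^2 + v^2"
    if p: "p = (c^2 + e^2) * r" and deg: "degree (c^2 + e^2) > 0" for c e r
  proof (cases "r = 0")
    case True
    then have "p = 0^2 + 0^2" using p by simp
    then show ?thesis by blast
  next
    case False
    have ne: "c^2 + e^2 \<noteq> 0" using deg by (metis degree_0 less_irrefl)
    have "degree p = degree (c^2 + e^2) + degree r"
      unfolding p by (rule degree_mult_eq[OF ne False])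
    then have "degree r < degree p" using deg by simp
    moreover have "\<And>x. 0 \<le> poly r x"
      by (rule nonneg_poly_cofactor[of "c^2 + e^2"]) (use less.prems[unfolded p] ne in auto)
    ultimately obtain u v where "r = u^2 + v^2" using less.hyps by blast
    then show ?thesis using p sum_two_squares_mult[OF refl, of r u v c e] by blast
  qed
  show ?case
  proof (cases "degree p = 0")
    case True
    then obtain c where c: "p = [:c:]" by (metis degree_eq_zeroE)
    have "0 \<le> c" using less.prems[of 0] c by simp
    then have "p = [:sqrt c:]^2 + 0^2" using c by (simp add: power2_eq_square)
    then show ?thesis by blast
  next
    case False
    let ?P = "map_poly of_real p :: complex poly"
    have "degree ?P \<noteq> 0" using False by (simp add: degree_map_poly)
    then obtain w where w: "poly ?P w = 0"
      using fundamental_theorem_of_algebra[of ?P] by (auto simp: constant_degree)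
    show ?thesis
    proof (cases "Im w = 0")
      case True
      define a where "a = Re w"
      have "w = of_real a" using True by (simp add: a_def complex_eq_iff)
      moreover have "poly (map_poly of_real p :: complex poly) (of_real a) = of_real (poly p a)"
        by (induction p) (auto simp: map_poly_pCons)
      ultimately have "(of_real (poly p a) :: complex) = 0" using w by simp
      then have "poly p a = 0" by simp
      then obtain q where q: "p = [:-a,1:] * q" by (auto simp: poly_eq_0_iff_dvd dvd_def)
      \<comment> \<open>A real root is a minimum of the nonnegative \<open>p\<close>, so the
        derivative vanishes there and the root is at least double.\<close>
      have "poly (pderiv p) a = 0"
        by (rule DERIV_local_min[OF poly_DERIV, of 1 a]) (use less.prems \<open>poly p a = 0\<close> in auto)
      then have "poly q a = 0" by (simp add: q pderiv_diff pderiv_smult pderiv_pCons)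
      then obtain r where "q = [:-a,1:] * r" by (auto simp: poly_eq_0_iff_dvd dvd_def)
      then have "p = ([:-a,1:]^2 + 0^2) * r"
        unfolding q by (simp only: power2_eq_square mult.assoc mult_zero_left add_0_right)
      then show ?thesis by (rule factor) (simp add: power2_eq_square)
    next
      case False
      \<comment> \<open>The minimal polynomial of \<open>w\<close> over the reals. The remainder of
        \<open>p\<close> modulo it has degree below 2 and the nonreal root \<open>w\<close>, hence
        is zero.\<close>
      let ?Q = "[:- Re w,1:]^2 + [:Im w:]^2 :: real poly"
      have Q: "?Q = [:(Re w)^2 + (Im w)^2, - 2 * Re w, 1:]" by (simp add: power2_eq_square)
      have Qw: "poly (map_poly of_real ?Q) w = 0"
        unfolding Q by (simp add: map_poly_pCons complex_eq_iff power2_eq_square algebra_simps)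
      define m where "m = p mod ?Q"
      have "degree m < 2"
        using degree_mod_less[of ?Q p] unfolding m_def Q by auto
      then have m: "m = [:coeff m 0, coeff m 1:]"
        by (intro poly_eqI) (auto simp: coeff_pCons coeff_eq_0 split: nat.splits)
      have eq: "p = ?Q * (p div ?Q) + m" unfolding m_def by simp
      have ha: "map_poly of_real (a + b :: real poly) = map_poly of_real a + (map_poly of_real b :: complex poly)" for a b
        by (simp add: poly_eq_iff coeff_map_poly)
      have hm: "map_poly of_real (a * b :: real poly) = map_poly of_real a * (map_poly of_real b :: complex poly)" for a b
        by (simp add: poly_eq_iff coeff_map_poly coeff_mult)
      have "map_poly of_real p = map_poly of_real ?Q * map_poly of_real (p div ?Q) + (map_poly of_real m :: complex poly)"
        by (subst eq) (simp only: ha hm)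
      then have "poly (map_poly of_real m) w = 0" using w Qw by simp
      then have "of_real (coeff m 0) + w * of_real (coeff m 1) = 0"
        by (subst (asm) m) (simp add: map_poly_pCons)
      then have "coeff m 1 = 0 \<and> coeff m 0 = 0" using False by (auto simp: complex_eq_iff)
      then have "m = 0" using m by simp
      then have "p = ?Q * (p div ?Q)" using eq by simp
      then show ?thesis by (rule factor) (simp add: Q)
    qed
  qed
qed

section \<open>The Riesz functional of a moment sequence\<close>

definition moment_functional :: "(nat \<Rightarrow> real) \<Rightarrow> real poly \<Rightarrow> real" where
  "moment_functional s p = (\<Sum>i\<le>degree p. coeff p i * s i)"

lemma moment_functional_altdef:
  assumes "degree p \<le> n"
  shows "moment_functional s p = (\<Sum>i\<le>n. coeff p i * s i)"
  unfolding moment_functional_def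
  using assms by (intro sum.mono_neutral_left) (auto simp: coeff_eq_0 not_le)

lemma moment_functional_add: "moment_functional s (p + q) = moment_functional s p + moment_functional s q"
proof -
  let ?n = "max (degree p) (degree q)"
  show ?thesis
    using degree_add_le_max[of p q]
    by (simp add: moment_functional_altdef[of _ ?n] sum.distrib distrib_right)
qed

lemma moment_functional_0 [simp]: "moment_functional s 0 = 0"
  by (simp add: moment_functional_def)

lemma moment_functional_sum: "moment_functional s (\<Sum>i\<in>A. p i) = (\<Sum>i\<in>A. moment_functional s (p i))"
  by (induction A rule: infinite_finite_induct) (auto simp: moment_functional_add)

lemma moment_functional_monom: "moment_functional s (monom c k) = c * s k"
  by (subst moment_functional_altdef[OF degree_monom_le])
     (simp add: if_distrib[of "\<lambda>x. x * _"] cong: if_cong)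

lemma moment_functional_square_nonneg:
  assumes "positive_seq s"
  shows "0 \<le> moment_functional s (u^2)"
proof -
  have "u * u = (\<Sum>i\<le>degree u. \<Sum>j\<le>degree u. monom (coeff u i * coeff u j) (i + j))"
    by (subst (1 2) poly_as_sum_of_monoms[symmetric, of u])
       (simp add: sum_product mult_monom)
  then have "moment_functional s (u^2) = (\<Sum>i\<le>degree u. \<Sum>j\<le>degree u. coeff u i * coeff u j * s (i + j))"
    by (simp add: power2_eq_square moment_functional_sum moment_functional_monom)
  then show ?thesis using assms by (simp add: positive_seq_def)
qed

lemma moment_functional_nonneg:
  assumes "positive_seq s" "\<And>x. 0 \<le> poly p x"
  shows "0 \<le> moment_functional s p"
proof -
  obtain u v where "p = u^2 + v^2" using nonneg_poly_sum_two_squares[OF assms(2)] by blast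
  then show ?thesis using assms(1) by (simp add: moment_functional_add moment_functional_square_nonneg)
qed

text \<open>Positivity on nonnegative polynomials in terms of coefficient vectors, the form that the
  separation argument uses.\<close>

lemma positive_seq_nonneg_sum:
  assumes "positive_seq s" "\<And>x. 0 \<le> (\<Sum>k\<le>n. c k * x ^ k)"
  shows "0 \<le> (\<Sum>k\<le>n. c k * s k)"
proof -
  have "0 \<le> moment_functional s (\<Sum>k\<le>n. monom (c k) k)"
    using assms by (intro moment_functional_nonneg) (auto simp: poly_sum poly_monom)
  then show ?thesis by (simp add: moment_functional_sum moment_functional_monom)
qed

section \<open>Existence of solutions of the Hamburger moment problem\<close>

text \<open>The convex cone of moment sequences of finitely supported measures, with nodes
  \<open>x i\<close> and masses \<open>w i\<close>; nodes may coincide.\<close>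

definition atomic_moments :: "(nat \<Rightarrow> real) set" where
  "atomic_moments = {v. \<exists>(m::nat) w x. (\<forall>i<m. 0 \<le> w i) \<and> v = (\<lambda>k. \<Sum>i<m. w i * x i ^ k)}"

lemma atomic_moments_zero: "(\<lambda>_. 0) \<in> atomic_moments"
  unfolding atomic_moments_def by (auto intro!: exI[of _ 0])

lemma atomic_moments_scale:
  assumes "v \<in> atomic_moments" "0 \<le> c"
  shows "(\<lambda>k. c * v k) \<in> atomic_moments"
proof -
  obtain m :: nat and w x where m: "\<forall>i<m. 0 \<le> w i" "v = (\<lambda>k. \<Sum>i<m. w i * x i ^ k)"
    using assms(1) unfolding atomic_moments_def by blast
  have "\<forall>i<m. 0 \<le> c * w i" "(\<lambda>k. c * v k) = (\<lambda>k. \<Sum>i<m. (c * w i) * x i ^ k)"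
    using m assms(2) by (auto simp: sum_distrib_left mult.assoc)
  then show ?thesis unfolding atomic_moments_def by (auto intro: exI[of _ m] exI[of _ "\<lambda>i. c * w i"])
qed

lemma atomic_moments_add_point:
  assumes "v \<in> atomic_moments" "0 \<le> c"
  shows "(\<lambda>k. v k + c * t ^ k) \<in> atomic_moments"
proof -
  obtain m :: nat and w x where m: "\<forall>i<m. 0 \<le> w i" "v = (\<lambda>k. \<Sum>i<m. w i * x i ^ k)"
    using assms(1) unfolding atomic_moments_def by blast
  have "\<forall>i<Suc m. 0 \<le> (w(m := c)) i"
       "(\<lambda>k. v k + c * t ^ k) = (\<lambda>k. \<Sum>i<Suc m. (w(m := c)) i * (x(m := t)) i ^ k)"
    using m assms(2) by auto
  then show ?thesis unfolding atomic_moments_def by blast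
qed

lemma abs_power_le_one_plus_even_power:
  fixes x :: real
  assumes "k \<le> 2 * m"
  shows "\<bar>x\<bar> ^ k \<le> 1 + x ^ (2 * m)"
proof (cases "\<bar>x\<bar> \<le> 1")
  case True
  then have "\<bar>x\<bar> ^ k \<le> 1" by (simp add: power_le_one)
  then show ?thesis by (smt (verit) power_mult zero_le_power2 zero_le_power)
next
  case False
  then have "\<bar>x\<bar> ^ k \<le> \<bar>x\<bar> ^ (2 * m)" using assms by (intro power_increasing) auto
  then show ?thesis by (simp add: power_mult)
qed

text \<open>As \<open>N\<close> is even, each |t^k| with \<open>k \<le> N\<close> is at most 1 +
  t^N. This controls the second-order term when an atom at \<open>t\<close> is added to an element
  of the cone.\<close>

lemma sum_power_square_le:
  fixes t :: real
  assumes "even N"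
  shows "(\<Sum>k\<le>N. (t ^ k)^2) \<le> (N + 1) * (1 + t ^ N)^2"
proof -
  obtain m where m: "N = 2 * m" using assms by (rule evenE)
  have "(t ^ k)^2 \<le> (1 + t ^ N)^2" if "k \<le> N" for k
  proof -
    have "\<bar>t ^ k\<bar> \<le> 1 + t ^ N"
      using abs_power_le_one_plus_even_power[of k m t] that by (simp add: power_abs m)
    then show ?thesis by (metis abs_ge_zero power2_abs power_mono)
  qed
  then have "(\<Sum>k\<le>N. (t ^ k)^2) \<le> (\<Sum>k\<le>N. (1 + t ^ N)^2)" by (intro sum_mono) auto
  then show ?thesis by (simp add: add.commute)
qed

text \<open>
  A finite-dimensional separation argument carried out with a near-minimiser \<open>v\<close> of the distance \<open>D\<close>
  from \<open>s\<close> to the convex cone, since the cone is not closed: if the distance were positive, \<open>v - s\<close>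
  would be the coefficient vector of an almost nonnegative polynomial on which \<open>s\<close> is clearly
  negative.
\<close>
lemma positive_seq_atomic_approx:
  assumes s: "positive_seq s" and e: "0 < (e::real)"
  shows "\<exists>v \<in> atomic_moments. \<forall>k\<le>2*n. \<bar>v k - s k\<bar> < e"
proof -
  define N where "N = 2 * n"
  define D where "D v = (\<Sum>k\<le>N. (v k - s k)^2)" for v
  define \<delta> where "\<delta> = Inf (D ` atomic_moments)"
  have D0: "0 \<le> D v" for v unfolding D_def by (intro sum_nonneg) auto
  have bdd: "bdd_below (D ` atomic_moments)" by (rule bdd_belowI[of _ 0]) (use D0 in auto)
  have ne: "D ` atomic_moments \<noteq> {}" using atomic_moments_zero by blast
  have \<delta>_le: "\<delta> \<le> D v" if "v \<in> atomic_moments" for v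
    unfolding \<delta>_def using that bdd by (intro cInf_lower) auto
  have near: "\<exists>v\<in>atomic_moments. D v < \<delta> + \<eta>" if "\<eta> > 0" for \<eta>
    using cInf_lessD[OF ne, of "\<delta> + \<eta>"] that unfolding \<delta>_def by auto
  have "\<delta> \<ge> 0" unfolding \<delta>_def using ne D0 by (intro cInf_greatest) auto
  have "\<delta> = 0"
  proof (rule ccontr)
    assume "\<delta> \<noteq> 0"
    with \<open>\<delta> \<ge> 0\<close> have \<delta>: "\<delta> > 0" by simp
    define S where "S = (\<Sum>k\<le>N. (s k)^2)"
    \<comment> \<open>\<open>A\<close> gathers the constants of the estimates below, so that they
      end in \<open>\<delta> \<le> h * A\<close>, against the choice of \<open>h\<close>.\<close>
    define A where "A = 1 + 2 * (\<delta> + 1) + 2 * S + (N + 2) * \<bar>s 0 + s N\<bar>"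
    have S0: "S \<ge> 0" unfolding S_def by (intro sum_nonneg) auto
    have A: "A > 0" unfolding A_def using \<delta> S0 by (intro add_pos_nonneg) auto
    \<comment> \<open>The bound 1 on \<open>h\<close> keeps \<open>(1 - h) * v k\<close> in the cone
      and \<open>D v\<close> below \<open>\<delta> + 1\<close>.\<close>
    define h where "h = min 1 (\<delta> / (2 * A))"
    have h: "0 < h" "h \<le> 1" "h * A < \<delta>"
    proof -
      show "0 < h" "h \<le> 1" unfolding h_def using \<delta> A by auto
      have "h \<le> \<delta> / (2 * A)" unfolding h_def by simp
      then have "h * (2 * A) \<le> \<delta>" using A by (simp add: field_simps)
      then show "h * A < \<delta>" using \<delta> by simp
    qed
    \<comment> \<open>Precision \<open>h^2\<close> matches the second-order terms of the two
      variations made below, adding an atom and shrinking \<open>v\<close>.\<close>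
    obtain v where v: "v \<in> atomic_moments" "D v < \<delta> + h^2" using near[of "h^2"] h by auto
    define y where "y k = v k - s k" for k
    define q where "q t = (\<Sum>k\<le>N. y k * t ^ k)" for t
    have Dv: "D v = (\<Sum>k\<le>N. (y k)^2)" unfolding D_def y_def ..
    \<comment> \<open>Adding mass \<open>\<tau>\<close> at \<open>t\<close> cannot bring
      \<open>D\<close> below \<open>\<delta>\<close>. The mass is scaled by \<open>1 + t ^ N\<close>
      so that the quadratic term is at most \<open>(N + 1) * h^2\<close> uniformly in
      \<open>t\<close>.\<close>
    have q: "0 \<le> q t + h * (N + 2) * (1 + t ^ N)" for t
    proof -
      have "1 + t ^ N \<ge> 1" unfolding N_def by (simp add: power_mult)
      define \<tau> where "\<tau> = h / (1 + t ^ N)"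
      have \<tau>: "\<tau> > 0" "\<tau> * (1 + t ^ N) = h"
        unfolding \<tau>_def using h \<open>1 + t ^ N \<ge> 1\<close> by auto
      have "\<delta> \<le> D (\<lambda>k. v k + \<tau> * t ^ k)"
        using \<tau> v(1) by (intro \<delta>_le atomic_moments_add_point) auto
      also have "\<dots> = (\<Sum>k\<le>N. (y k)^2 + 2 * \<tau> * (y k * t ^ k) + \<tau>^2 * (t ^ k)^2)"
        unfolding D_def y_def by (intro sum.cong) (auto simp: power2_eq_square algebra_simps)
      also have "\<dots> = D v + 2 * \<tau> * q t + \<tau>^2 * (\<Sum>k\<le>N. (t ^ k)^2)"
        unfolding Dv q_def by (simp only: sum.distrib sum_distrib_left)
      also have "\<dots> \<le> D v + 2 * \<tau> * q t + \<tau>^2 * ((N + 1) * (1 + t ^ N)^2)"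
        using sum_power_square_le[of N t] by (intro add_left_mono mult_left_mono) (auto simp: N_def add.commute)
      also have "\<tau>^2 * ((N + 1) * (1 + t ^ N)^2) = (N + 1) * h^2"
        by (simp flip: \<tau>(2) add: power_mult_distrib)
      finally have "0 \<le> 2 * \<tau> * q t + (N + 2) * h^2" using v(2) by (simp add: algebra_simps)
      \<comment> \<open>The doubling turns the sum into a multiple of \<open>2 * \<tau>\<close>
        without fractions, since \<open>h = \<tau> * (1 + t ^ N)\<close>.\<close>
      also have "\<dots> \<le> 2 * \<tau> * q t + 2 * (N + 2) * h^2"
        by (intro add_left_mono mult_right_mono) auto
      also have "\<dots> = 2 * \<tau> * (q t + h * (N + 2) * (1 + t ^ N))"
        by (simp flip: \<tau>(2) add: power2_eq_square algebra_simps)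
      finally show ?thesis using \<tau>(1) by (simp add: zero_le_mult_iff)
    qed
    \<comment> \<open>Coefficients of \<open>q t + h * (N + 2) * (1 + t ^ N)\<close>, now truly
      nonnegative; both corrections fall on index 0 when \<open>N = 0\<close>.\<close>
    define c where "c k = y k + h * (N + 2) * (of_bool (k = 0) + of_bool (k = N))" for k
    have delta_sum: "(\<Sum>k\<le>N. c k * g k) = (\<Sum>k\<le>N. y k * g k) + h * (N + 2) * (g 0 + g N)" for g
      unfolding c_def
      by (simp add: distrib_right distrib_left sum.distrib mult.assoc flip: sum_distrib_left)
    have "0 \<le> (\<Sum>k\<le>N. c k * s k)"
      using q by (intro positive_seq_nonneg_sum[OF s]) (simp add: delta_sum q_def)
    then have 1: "0 \<le> (\<Sum>k\<le>N. y k * s k) + h * (N + 2) * \<bar>s 0 + s N\<bar>"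
      unfolding delta_sum using h by (smt (verit) mult_left_mono of_nat_0_le_iff mult_nonneg_nonneg)
    \<comment> \<open>Second variation: shrinking \<open>v\<close> stays in the cone and bounds the
      inner product of \<open>y\<close> and \<open>v\<close> by a multiple of
      \<open>h\<close>.\<close>
    have "\<delta> \<le> D (\<lambda>k. (1 - h) * v k)" using h v(1) by (intro \<delta>_le atomic_moments_scale) auto
    also have "\<dots> = (\<Sum>k\<le>N. (y k)^2 - 2 * h * (y k * v k) + h^2 * (v k)^2)"
      unfolding D_def y_def by (intro sum.cong) (auto simp: power2_eq_square algebra_simps)
    also have "\<dots> = D v - 2 * h * (\<Sum>k\<le>N. y k * v k) + h^2 * (\<Sum>k\<le>N. (v k)^2)"
      unfolding Dv by (simp only: sum.distrib sum_subtractf sum_distrib_left)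
    finally have "h * (2 * (\<Sum>k\<le>N. y k * v k)) \<le> h * (h * (1 + (\<Sum>k\<le>N. (v k)^2)))"
      using v(2) by (simp add: power2_eq_square algebra_simps)
    then have 2: "2 * (\<Sum>k\<le>N. y k * v k) \<le> h * (1 + (\<Sum>k\<le>N. (v k)^2))"
      using h(1) by (simp only: mult_le_cancel_left_pos)
    have "(\<Sum>k\<le>N. (v k)^2) \<le> (\<Sum>k\<le>N. 2 * (y k)^2 + 2 * (s k)^2)"
    proof (rule sum_mono)
      fix k
      have "0 \<le> (y k - s k)^2" by simp
      then show "(v k)^2 \<le> 2 * (y k)^2 + 2 * (s k)^2"
        unfolding y_def by (simp add: power2_eq_square algebra_simps)
    qed
    also have "\<dots> = 2 * D v + 2 * S" unfolding Dv S_def by (simp add: sum.distrib sum_distrib_left)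
    also have "\<dots> \<le> 2 * (\<delta> + 1) + 2 * S"
      using v(2) h by (smt (verit) power_le_one)
    finally have "2 * (\<Sum>k\<le>N. y k * v k) \<le> h * (1 + (2 * (\<delta> + 1) + 2 * S))"
      using 2 h(1) by (smt (verit) mult_left_mono)
    moreover have "0 \<le> h * (1 + (2 * (\<delta> + 1) + 2 * S))" using h \<delta> S0 by simp
    ultimately have 3: "(\<Sum>k\<le>N. y k * v k) \<le> h * (1 + (2 * (\<delta> + 1) + 2 * S))" by linarith
    \<comment> \<open>As \<open>s = v - y\<close>, the inner product of \<open>y\<close> with
      \<open>s\<close> is that with \<open>v\<close> minus \<open>D v\<close>, so it is close to or
      below \<open>- \<delta>\<close>, against its lower bound of order \<open>h\<close>.\<close>
    have "(\<Sum>k\<le>N. y k * s k) = (\<Sum>k\<le>N. y k * v k) - D v"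
      unfolding Dv by (simp add: y_def power2_eq_square algebra_simps flip: sum_subtractf)
    moreover have "\<delta> \<le> D v" using v(1) by (rule \<delta>_le)
    ultimately have "\<delta> \<le> h * (1 + (2 * (\<delta> + 1) + 2 * S)) + h * (N + 2) * \<bar>s 0 + s N\<bar>"
      using 1 3 by linarith
    also have "\<dots> = h * A" unfolding A_def by (simp add: algebra_simps)
    finally show False using h(3) by simp
  qed
  then obtain v where v: "v \<in> atomic_moments" "D v < e^2" using near[of "e^2"] e by auto
  have "\<bar>v k - s k\<bar> < e" if "k \<le> 2 * n" for k
  proof -
    have "(v k - s k)^2 \<le> D v" unfolding D_def
      by (rule member_le_sum) (use that in \<open>auto simp: N_def\<close>)
    then have "\<bar>v k - s k\<bar>^2 < e^2" using v(2) by simp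
    then show ?thesis using e by (simp add: power2_less_imp_less)
  qed
  then show ?thesis using v(1) by blast
qed

section \<open>Clamped powers: bounded continuous test functions for limits of moments\<close>

definition clamp_at :: "real \<Rightarrow> real \<Rightarrow> real" where
  "clamp_at R x = max (- R) (min R x)"

lemma abs_clamp_at: "0 \<le> R \<Longrightarrow> \<bar>clamp_at R x\<bar> = min R \<bar>x\<bar>"
  by (auto simp: clamp_at_def)

lemma isCont_clamp_at: "isCont (\<lambda>x. clamp_at R x ^ k) x"
  unfolding clamp_at_def by (intro continuous_intros)

lemma measurable_clamp_at [measurable]: "clamp_at R \<in> borel_measurable borel"
  unfolding clamp_at_def by measurable

lemma abs_power_clamp_at_le:
  assumes "0 \<le> R"
  shows "\<bar>clamp_at R x ^ k\<bar> \<le> R ^ k"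
  unfolding power_abs abs_clamp_at[OF assms] using assms by (intro power_mono) auto

text \<open>The error is zero for |x| \<le> R and at most |x|^k \<le> |x|^(k+1) / R beyond; a higher
  even moment pays for the factor 1/R.\<close>

lemma clamp_power_error:
  assumes "1 \<le> R"
  shows "\<bar>x ^ k - clamp_at R x ^ k\<bar> \<le> (1 + x ^ (2 * (k + 1))) / R"
proof (cases "\<bar>x\<bar> \<le> R")
  case True
  then have "clamp_at R x = x" by (auto simp: clamp_at_def)
  then show ?thesis using assms by (simp add: zero_le_even_power del: power_Suc mult_Suc_right)
next
  case False
  have "R ^ k \<le> \<bar>x\<bar> ^ k" using False assms by (intro power_mono) auto
  have "\<bar>x ^ k - clamp_at R x ^ k\<bar> \<le> \<bar>x\<bar> ^ k"
  proof (cases "x > 0")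
    case True
    then have "clamp_at R x = R" using False assms by (auto simp: clamp_at_def)
    then show ?thesis using True \<open>R ^ k \<le> \<bar>x\<bar> ^ k\<close> assms by simp
  next
    case False': False
    then have *: "clamp_at R x = - R" using False assms by (auto simp: clamp_at_def)
    have "x ^ k - clamp_at R x ^ k = (- 1) ^ k * (\<bar>x\<bar> ^ k - R ^ k)"
    proof -
      have "x = - \<bar>x\<bar>" using False' by simp
      then have "x ^ k = (- 1) ^ k * \<bar>x\<bar> ^ k" by (metis power_minus)
      then show ?thesis unfolding * power_minus[of R] by (simp add: right_diff_distrib)
    qed
    then have "\<bar>x ^ k - clamp_at R x ^ k\<bar> = \<bar>\<bar>x\<bar> ^ k - R ^ k\<bar>" by (simp add: abs_mult)
    then show ?thesis using \<open>R ^ k \<le> \<bar>x\<bar> ^ k\<close> assms by simp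
  qed
  moreover have "\<bar>x\<bar> ^ k * R \<le> \<bar>x\<bar> ^ (k + 1)"
    using False by (simp add: mult.commute mult_right_mono)
  moreover have "\<bar>x\<bar> ^ (k + 1) \<le> 1 + x ^ (2 * (k + 1))" by (rule abs_power_le_one_plus_even_power) simp
  ultimately have "\<bar>x ^ k - clamp_at R x ^ k\<bar> * R \<le> 1 + x ^ (2 * (k + 1))"
    using assms by (smt (verit) mult_right_mono)
  then show ?thesis using assms by (simp add: field_simps)
qed

lemma (in real_distribution) integral_clamp_power_error:
  assumes "1 \<le> R" and int: "\<And>k. integrable M (\<lambda>x. x ^ k)"
  shows "\<bar>(\<integral>x. x ^ k \<partial>M) - (\<integral>x. clamp_at R x ^ k \<partial>M)\<bar> \<le> (1 + (\<integral>x. x ^ (2 * (k + 1)) \<partial>M)) / R"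
proof -
  have ic: "integrable M (\<lambda>x. clamp_at R x ^ k)"
    by (rule integrable_const_bound[of _ "R ^ k"]) (use assms(1) abs_power_clamp_at_le in auto)
  have "\<bar>(\<integral>x. x ^ k \<partial>M) - (\<integral>x. clamp_at R x ^ k \<partial>M)\<bar> = \<bar>\<integral>x. x ^ k - clamp_at R x ^ k \<partial>M\<bar>"
    using ic int by simp
  also have "\<dots> \<le> (\<integral>x. \<bar>x ^ k - clamp_at R x ^ k\<bar> \<partial>M)"
    by (rule integral_abs_bound)
  also have "\<dots> \<le> (\<integral>x. (1 + x ^ (2 * (k + 1))) / R \<partial>M)"
    by (intro integral_mono Bochner_Integration.integrable_diff integrable_abs integrable_divide
          Bochner_Integration.integrable_add integrable_const int ic clamp_power_error[OF assms(1)])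
  also have "\<dots> = (1 + (\<integral>x. x ^ (2 * (k + 1)) \<partial>M)) / R"
    using int[of "2 * (k + 1)"] prob_space by (simp del: power_Suc mult_Suc_right)
  finally show ?thesis .
qed

lemma tight_if_second_moments_bounded:
  assumes P: "\<And>n. real_distribution (P n)"
    and int: "\<And>n. integrable (P n) (\<lambda>x. x^2)"
    and B: "\<And>n. (\<integral>x. x^2 \<partial>P n) \<le> B"
  shows "tight P"
  unfolding tight_def
proof (intro conjI allI impI)
  fix \<epsilon> :: real assume \<epsilon>: "0 < \<epsilon>"
  have "0 \<le> (\<integral>x. x^2 \<partial>P 0)" by (rule integral_nonneg_AE) simp
  with B[of 0] have B0: "0 \<le> B" by linarith
  \<comment> \<open>This choice gives \<open>1 \<le> r\<close> and
    \<open>B / \<epsilon> < r \<le> r^2\<close>, so Markov's inequality at level \<open>r^2\<close>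
    leaves mass below \<open>\<epsilon>\<close> outside.\<close>
  define r where "r = B / \<epsilon> + 1"
  have r1: "1 \<le> r" unfolding r_def using B0 \<epsilon> by simp
  have "B / \<epsilon> < r" by (simp add: r_def)
  also have "r \<le> r^2" using r1 by (simp add: power2_eq_square)
  finally have r: "B / r^2 < \<epsilon>" using \<epsilon> r1 by (simp add: field_simps)
  have "1 - \<epsilon> < measure (P n) {-r<..r}" for n
  proof -
    interpret real_distribution "P n" by (rule P)
    have "measure (P n) {x\<in>space (P n). r^2 \<le> x^2} \<le> (\<integral>x. x^2 \<partial>P n) / r^2"
      using int[of n] r1 by (intro integral_Markov_inequality_measure[where A = "{}"]) auto
    also have "\<dots> \<le> B / r^2" using B[of n] by (intro divide_right_mono) auto
    finally have *: "measure (P n) {x. r^2 \<le> x^2} < \<epsilon>" using r by simp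
    have [measurable]: "{x::real. r^2 \<le> x^2} \<in> sets borel" by measurable
    have "1 = measure (P n) UNIV" using prob_space by simp
    also have "UNIV = {x. r^2 \<le> x^2} \<union> {-r<..r}"
    proof -
      have "x \<in> {-r<..r}" if "\<not> r^2 \<le> x^2" for x
      proof -
        have "\<bar>x\<bar>^2 < r^2" using that by simp
        then have "\<bar>x\<bar> < r" using r1 by (meson less_le_trans zero_le_one power2_less_imp_less order.trans)
        then show ?thesis by auto
      qed
      then show ?thesis by blast
    qed
    also have "measure (P n) \<dots> \<le> measure (P n) {x. r^2 \<le> x^2} + measure (P n) {-r<..r}"
      by (rule measure_Un_le) auto
    finally show ?thesis using * by linarith
  qed
  moreover have "-r < r" using r1 by simp
  ultimately show "\<exists>a b. a < b \<and> (\<forall>n. 1 - \<epsilon> < measure (P n) {a<..b})" by blast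
qed (rule P)

text \<open>Convergent moments are bounded, so the sequence is tight and has a weakly convergent
  subsequence. Powers are unbounded and therefore clamped at \<open>R\<close>; the error is O(1/R)
  uniformly in \<open>n\<close>, and \<open>R\<close> tends to infinity last.\<close>

lemma real_distribution_moment_limit:
  assumes P: "\<And>n. real_distribution (P n)"
    and int: "\<And>n k. integrable (P n) (\<lambda>x. x ^ k)"
    and lim: "\<And>k. (\<lambda>n. \<integral>x. x ^ k \<partial>P n) \<longlonglongrightarrow> t k"
  shows "\<exists>M. real_distribution M \<and> (\<forall>k. integrable M (\<lambda>x. x ^ k) \<and> (\<integral>x. x ^ k \<partial>M) = t k)"
proof -
  have "\<exists>B. \<forall>n. (\<integral>x. x ^ k \<partial>P n) \<le> B" for k
  proof -
    have "Bseq (\<lambda>n. \<integral>x. x ^ k \<partial>P n)"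
      using lim[of k] by (intro convergent_imp_Bseq convergentI)
    then obtain B where "\<forall>n. norm (\<integral>x. x ^ k \<partial>P n) \<le> B" by (auto elim: BseqE)
    then show ?thesis by (auto intro!: exI[of _ B] dest: abs_le_D1)
  qed
  then obtain B where B: "\<And>k n. (\<integral>x. x ^ k \<partial>P n) \<le> B k" by metis
  have "tight P" using P int B by (intro tight_if_second_moments_bounded) auto
  from tight_imp_convergent_subsubsequence[OF this strict_mono_id]
  obtain r M where r: "strict_mono (r :: nat \<Rightarrow> nat)" and M: "real_distribution M"
    and wc: "weak_conv_m (P \<circ> id \<circ> r) M" by blast
  define Q where "Q n = P (r n)" for n
  have Q: "\<And>n. real_distribution (Q n)" "\<And>n k. integrable (Q n) (\<lambda>x. x ^ k)"
    "\<And>k n. (\<integral>x. x ^ k \<partial>Q n) \<le> B k" using P int B by (auto simp: Q_def)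
  have Qlim: "(\<lambda>n. \<integral>x. x ^ k \<partial>Q n) \<longlonglongrightarrow> t k" for k
    unfolding Q_def using LIMSEQ_subseq_LIMSEQ[OF lim r] by (simp add: o_def)
  have wc: "weak_conv_m Q M" using wc by (simp add: Q_def[abs_def] o_def)
  interpret M: real_distribution M by (rule M)
  have cl: "(\<lambda>n. \<integral>x. clamp_at R x ^ k \<partial>Q n) \<longlonglongrightarrow> (\<integral>x. clamp_at R x ^ k \<partial>M)" if "0 \<le> R" for R k
    by (rule weak_conv_imp_integral_bdd_continuous_conv[OF Q(1) M wc isCont_clamp_at, where B = "R ^ k"])
       (use abs_power_clamp_at_le[OF that] in auto)
  have icQ: "integrable (Q n) (\<lambda>x. clamp_at R x ^ k)" if "0 \<le> R" for R k n
  proof -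
    interpret real_distribution "Q n" by (rule Q)
    show ?thesis by (rule integrable_const_bound[of _ "R ^ k"]) (use that abs_power_clamp_at_le in auto)
  qed
  have icM: "integrable M (\<lambda>x. clamp_at R x ^ k)" if "0 \<le> R" for R k
    by (rule M.integrable_const_bound[of _ "R ^ k"]) (use that abs_power_clamp_at_le in auto)
  have even_power: "clamp_at R x ^ (2 * k) = min R \<bar>x\<bar> ^ (2 * k)" if "0 \<le> R" for R x k
    using abs_clamp_at[OF that, of x] by (metis power_even_abs even_mult_iff even_numeral)
  \<comment> \<open>Even powers of the clamped variable increase with the level, and their integrals
    stay below the common moment bound; monotone convergence gives integrability.\<close>
  have int_even: "integrable M (\<lambda>x. x ^ (2 * k))" for k
  proof -
    have le: "(\<integral>x. clamp_at (real i) x ^ (2 * k) \<partial>M) \<le> B (2 * k)" for i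
    proof (rule LIMSEQ_le_const2[OF cl])
      have "(\<integral>x. clamp_at (real i) x ^ (2 * k) \<partial>Q n) \<le> (\<integral>x. x ^ (2 * k) \<partial>Q n)" for n
      proof (rule integral_mono)
        fix x :: real
        have "min (real i) \<bar>x\<bar> ^ (2 * k) \<le> \<bar>x\<bar> ^ (2 * k)" by (intro power_mono) auto
        then show "clamp_at (real i) x ^ (2 * k) \<le> x ^ (2 * k)"
          by (simp add: even_power power_even_abs)
      qed (use icQ Q in auto)
      then show "\<exists>N. \<forall>n\<ge>N. (\<integral>x. clamp_at (real i) x ^ (2 * k) \<partial>Q n) \<le> B (2 * k)"
        using Q(3)[where k = "2 * k"] by (meson order.trans)
    qed simp
    have mono: "incseq (\<lambda>i. clamp_at (real i) x ^ (2 * k))" for x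
      by (rule incseq_SucI) (auto simp: even_power intro!: power_mono)
    have "incseq (\<lambda>i. \<integral>x. clamp_at (real i) x ^ (2 * k) \<partial>M)"
      using mono icM by (auto simp: incseq_def intro!: integral_mono)
    then obtain l where l: "(\<lambda>i. \<integral>x. clamp_at (real i) x ^ (2 * k) \<partial>M) \<longlonglongrightarrow> l"
      using incseq_convergent le by metis
    have pt: "(\<lambda>i. clamp_at (real i) x ^ (2 * k)) \<longlonglongrightarrow> x ^ (2 * k)" for x
    proof (rule tendsto_eventually)
      obtain n where n: "\<bar>x\<bar> \<le> real n" using real_arch_simple by blast
      show "\<forall>\<^sub>F i in sequentially. clamp_at (real i) x ^ (2 * k) = x ^ (2 * k)"
        using eventually_ge_at_top[of n]
      proof eventually_elim
        case (elim i)
        then have "\<bar>x\<bar> \<le> real i" using n by linarith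
        then have "clamp_at (real i) x = x" by (auto simp: clamp_at_def)
        then show ?case by simp
      qed
    qed
    show ?thesis
      by (rule integrable_monotone_convergence[OF _ _ _ l]) (use mono pt icM in \<open>auto simp: incseq_def mono_def\<close>)
  qed
  have intM: "integrable M (\<lambda>x. x ^ k)" for k
  proof (rule Bochner_Integration.integrable_bound)
    show "integrable M (\<lambda>x. 1 + x ^ (2 * k))" using int_even by simp
    show "AE x in M. norm (x ^ k) \<le> norm (1 + x ^ (2 * k))"
      using abs_power_le_one_plus_even_power[of k k] by (auto simp: power_abs intro: order.trans)
  qed simp
  have "(\<integral>x. x ^ k \<partial>M) = t k" for k
  proof -
    \<comment> \<open>The clamping errors along \<open>Q n\<close> and for \<open>M\<close>
      together, before division by \<open>R\<close>.\<close>
    define C where "C = (1 + B (2 * (k + 1))) + (1 + (\<integral>x. x ^ (2 * (k + 1)) \<partial>M))"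
    have bound: "\<bar>t k - (\<integral>x. x ^ k \<partial>M)\<bar> \<le> C / R" if R: "1 \<le> R" for R
    proof -
      have "\<bar>(\<integral>x. x ^ k \<partial>Q n) - (\<integral>x. clamp_at R x ^ k \<partial>Q n)\<bar> \<le> (1 + B (2 * (k + 1))) / R" for n
      proof -
        have "(1 + (\<integral>x. x ^ (2 * (k + 1)) \<partial>Q n)) / R \<le> (1 + B (2 * (k + 1))) / R"
          using Q(3)[of n "2 * (k + 1)"] R by (intro divide_right_mono) auto
        then show ?thesis
          using real_distribution.integral_clamp_power_error[OF Q(1) R Q(2), of n k] by linarith
      qed
      then have "\<bar>t k - (\<integral>x. clamp_at R x ^ k \<partial>M)\<bar> \<le> (1 + B (2 * (k + 1))) / R"
        using R by (intro LIMSEQ_le_const2[OF tendsto_rabs[OF tendsto_diff[OF Qlim cl]]]) auto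
      then show ?thesis
        using M.integral_clamp_power_error[OF R intM, of k] unfolding C_def add_divide_distrib by linarith
    qed
    have "\<bar>t k - (\<integral>x. x ^ k \<partial>M)\<bar> \<le> 0"
    proof (rule LIMSEQ_le_const)
      show "(\<lambda>n. C / real (Suc n)) \<longlonglongrightarrow> 0"
        by (rule LIMSEQ_Suc[OF lim_const_over_n])
    qed (use bound[of "real (Suc _)"] in auto)
    then show ?thesis by simp
  qed
  then show ?thesis using M intM by blast
qed

section \<open>Hamburger's theorem: normalised atomic measures and their limit\<close>

lemma atomic_moments_real_distribution:
  assumes "v \<in> atomic_moments" "0 < v 0"
  shows "\<exists>P. real_distribution P \<and> (\<forall>k. integrable P (\<lambda>x. x ^ k) \<and> (\<integral>x. x ^ k \<partial>P) = v k / v 0)"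
proof -
  obtain m :: nat and w x where m: "\<forall>i<m. 0 \<le> w i" "v = (\<lambda>k. \<Sum>i<m. w i * x i ^ k)"
    using assms(1) unfolding atomic_moments_def by blast
  \<comment> \<open>The measure lives on the index set, so coinciding nodes add their masses under
    the push-forward; division by the total mass \<open>v 0\<close> makes it a probability.\<close>
  define A where "A = point_measure {..<m} (\<lambda>i. ennreal (w i / v 0))"
  define P where "P = distr A borel x"
  have x [measurable]: "x \<in> measurable A borel" by (simp add: A_def)
  have "emeasure A (space A) = (\<Sum>i<m. ennreal (w i / v 0))"
    unfolding A_def by (simp add: space_point_measure emeasure_point_measure_finite)
  also have "\<dots> = ennreal (\<Sum>i<m. w i / v 0)"
    using m assms(2) by (intro sum_ennreal) (auto simp: divide_nonneg_nonneg)
  also have "(\<Sum>i<m. w i / v 0) = 1"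
    using assms(2) m(2) by (simp flip: sum_divide_distrib)
  finally have "prob_space A" by (intro prob_spaceI) simp
  then have "real_distribution P"
    unfolding P_def real_distribution_def real_distribution_axioms_def
    using prob_space.prob_space_distr[OF _ x] by simp
  moreover have "integrable P (\<lambda>x. x ^ k)" for k
    unfolding P_def by (subst integrable_distr_eq) (auto simp: A_def intro!: integrable_point_measure_finite)
  moreover have "(\<integral>x. x ^ k \<partial>P) = v k / v 0" for k
  proof -
    have "(\<integral>x. x ^ k \<partial>P) = (\<integral>i. x i ^ k \<partial>A)"
      unfolding P_def by (rule integral_distr) auto
    also have "\<dots> = (\<Sum>i<m. (w i / v 0) * x i ^ k)"
      unfolding A_def using m assms(2)
      by (subst lebesgue_integral_point_measure_finite) (auto simp: divide_nonneg_nonneg)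
    also have "\<dots> = v k / v 0" by (simp add: m(2) sum_divide_distrib)
    finally show ?thesis .
  qed
  ultimately show ?thesis by blast
qed

text \<open>Atomic measures that approximate ever more moments are normalised to probability
  measures; a weak limit, rescaled by \<open>s 0\<close>, is a solution.\<close>

theorem Hamburger_moment_existence:
  assumes s: "positive_seq s" and s0: "0 < s 0"
  shows "\<exists>M. moment_solution s M"
proof -
  \<comment> \<open>A tolerance of at most \<open>s 0\<close>, with strict inequality, keeps the
    total masses \<open>v n 0\<close> positive.\<close>
  have "\<exists>v\<in>atomic_moments. \<forall>k\<le>2*n. \<bar>v k - s k\<bar> < s 0 / real (Suc n)" for n
    using s s0 by (intro positive_seq_atomic_approx) auto
  then obtain v where v: "\<And>n. v n \<in> atomic_moments"
    "\<And>n k. k \<le> 2 * n \<Longrightarrow> \<bar>v n k - s k\<bar> < s 0 / real (Suc n)" by metis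
  have pos: "0 < v n 0" for n
  proof -
    have "s 0 / real (Suc n) \<le> s 0" using s0 by (simp add: field_simps)
    then show ?thesis using v(2)[of 0 n] by linarith
  qed
  have vlim: "(\<lambda>n. v n k) \<longlonglongrightarrow> s k" for k
  proof -
    have "(\<lambda>n. v n k - s k) \<longlonglongrightarrow> 0"
    proof (rule Lim_null_comparison)
      show "\<forall>\<^sub>F n in sequentially. norm (v n k - s k) \<le> s 0 / real (Suc n)"
        using eventually_ge_at_top[of k]
      proof eventually_elim
        case (elim n)
        then show ?case using v(2)[of k n] by simp
      qed
      show "(\<lambda>n. s 0 / real (Suc n)) \<longlonglongrightarrow> 0" by (rule LIMSEQ_Suc[OF lim_const_over_n])
    qed
    then show ?thesis by (simp add: LIM_zero_iff)
  qed
  obtain P where P: "\<And>n. real_distribution (P n)" "\<And>n k. integrable (P n) (\<lambda>x. x ^ k)"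
    "\<And>n k. (\<integral>x. x ^ k \<partial>P n) = v n k / v n 0"
    using atomic_moments_real_distribution[OF v(1) pos] by metis
  have "(\<lambda>n. \<integral>x. x ^ k \<partial>P n) \<longlonglongrightarrow> s k / s 0" for k
    unfolding P(3) using s0 by (intro tendsto_divide vlim) auto
  from real_distribution_moment_limit[OF P(1,2) this]
  obtain M where M: "real_distribution M" "\<And>k. integrable M (\<lambda>x. x ^ k)" "\<And>k. (\<integral>x. x ^ k \<partial>M) = s k / s 0"
    by blast
  interpret real_distribution M by (rule M)
  define N where "N = density M (\<lambda>_. ennreal (s 0))"
  have "finite_measure N"
    unfolding N_def by (intro finite_measureI) (simp add: emeasure_density ennreal_mult_eq_top_iff)
  moreover have "integrable N (\<lambda>x. x ^ k) \<and> (\<integral>x. x ^ k \<partial>N) = s k" for k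
    unfolding N_def using s0 M(2,3)[of k] by (simp add: integrable_density integral_density)
  ultimately have "moment_solution s N"
    unfolding moment_solution_def by (simp add: N_def)
  then show ?thesis by blast
qed

section \<open>Cauchy transforms\<close>

lemma norm_inverse_diff_le:
  assumes "Im z \<noteq> 0"
  shows "norm (1 / (complex_of_real x - z)) \<le> 1 / \<bar>Im z\<bar>"
proof -
  have "\<bar>Im z\<bar> \<le> norm (complex_of_real x - z)" using abs_Im_le_cmod[of "complex_of_real x - z"] by simp
  then show ?thesis using assms by (simp add: norm_divide frac_le)
qed

lemma integrable_Cauchy_kernel:
  fixes g :: "real \<Rightarrow> real"
  assumes "sets M = sets borel" "integrable M g" "Im z \<noteq> 0"
  shows "integrable M (\<lambda>x. complex_of_real (g x) / (complex_of_real x - z))"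
proof (rule Bochner_Integration.integrable_bound)
  show "integrable M (\<lambda>x. g x / \<bar>Im z\<bar>)" using assms by simp
  note [measurable_cong] = assms(1) and [measurable] = borel_measurable_integrable[OF assms(2)]
  show "(\<lambda>x. complex_of_real (g x) / (complex_of_real x - z)) \<in> borel_measurable M" by measurable
  have "norm (complex_of_real (g x) / (complex_of_real x - z)) \<le> norm (g x / \<bar>Im z\<bar>)" for x
    using mult_left_mono[OF norm_inverse_diff_le[OF assms(3), of x], of "\<bar>g x\<bar>"]
    by (simp add: norm_divide)
  then show "AE x in M. norm (complex_of_real (g x) / (complex_of_real x - z)) \<le> norm (g x / \<bar>Im z\<bar>)"
    by simp
qed

text \<open>Dominated convergence with majorant \<open>\<bar>f x\<bar> * C\<close>; it lets the test
  functions of the inversion argument pass to bounded pointwise limits.\<close>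

lemma integral_mult_bounded_limit:
  fixes f :: "real \<Rightarrow> real"
  assumes "sets M = sets borel" "integrable M f"
    and "\<And>n. g n \<in> borel_measurable borel"
    and "\<And>n x. \<bar>g n x\<bar> \<le> C" "\<And>x. (\<lambda>n. g n x) \<longlonglongrightarrow> h x"
    and "\<And>n. (\<integral>x. f x * g n x \<partial>M) = 0"
  shows "(\<integral>x. f x * h x \<partial>M) = 0"
proof -
  have [measurable]: "h \<in> borel_measurable borel" by (rule borel_measurable_LIMSEQ_real[OF assms(5,3)])
  note [measurable_cong] = assms(1) and [measurable] = assms(3) borel_measurable_integrable[OF assms(2)]
  have "(\<lambda>n. \<integral>x. f x * g n x \<partial>M) \<longlonglongrightarrow> (\<integral>x. f x * h x \<partial>M)"
  proof (rule integral_dominated_convergence[where w = "\<lambda>x. \<bar>f x\<bar> * C"])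
    show "integrable M (\<lambda>x. \<bar>f x\<bar> * C)" using assms(2) by simp
    show "AE x in M. (\<lambda>n. f x * g n x) \<longlonglongrightarrow> f x * h x"
      using assms(5) by (intro AE_I2 tendsto_mult_left)
    show "AE x in M. norm (f x * g n x) \<le> \<bar>f x\<bar> * C" for n
      using assms(4) by (intro AE_I2) (auto simp: abs_mult intro!: mult_left_mono)
  qed measurable
  then show ?thesis unfolding assms(6) by (simp add: LIMSEQ_const_iff)
qed

section \<open>Stieltjes inversion through Poisson integrals\<close>

lemma tendsto_arctan_sgn:
  fixes y :: real
  shows "(\<lambda>n. arctan (y * real (Suc n))) \<longlonglongrightarrow> pi / 2 * sgn y"
proof -
  have lim: "filterlim (\<lambda>n. real (Suc n)) at_top sequentially"
    by (rule filterlim_compose[OF filterlim_real_sequentially filterlim_Suc])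
  consider "y = 0" | "y > 0" | "y < 0" by linarith
  then show ?thesis
  proof cases
    case 2
    then show ?thesis
      using filterlim_compose[OF tendsto_arctan_at_top filterlim_tendsto_pos_mult_at_top[OF tendsto_const _ lim]] by simp
  next
    case 3
    then show ?thesis
      using filterlim_compose[OF tendsto_arctan_at_bot filterlim_tendsto_neg_mult_at_bot[OF tendsto_const _ lim]] by simp
  qed simp
qed

lemma has_bochner_integral_Poisson_kernel:
  fixes u v b x :: real
  assumes "b > 0" "u \<le> v"
  shows "has_bochner_integral lborel (\<lambda>a. b / ((x - a)^2 + b^2) * indicator {u..v} a)
           (arctan ((v - x) / b) - arctan ((u - x) / b))"
proof (rule has_bochner_integral_FTC_Icc_real[OF assms(2)])
  fix a
  have pos: "(x - a)^2 + b^2 > 0" using assms(1) by (simp add: add_nonneg_pos)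
  have "((\<lambda>a. arctan ((a - x) / b)) has_real_derivative (1 / b) * inverse (1 + ((a - x) / b)^2)) (at a)"
    using assms(1) by (auto intro!: derivative_eq_intros)
  moreover have "(1 / b) * inverse (1 + ((a - x) / b)^2) = b / ((x - a)^2 + b^2)"
  proof -
    have "1 + ((a - x) / b)^2 = ((x - a)^2 + b^2) / b^2"
      using assms(1) by (simp add: field_simps power2_commute)
    then show ?thesis using assms(1) by (simp add: power2_eq_square)
  qed
  ultimately show "((\<lambda>a. arctan ((a - x) / b)) has_real_derivative b / ((x - a)^2 + b^2)) (at a)" by simp
  show "isCont (\<lambda>a. b / ((x - a)^2 + b^2)) a" using pos by (intro continuous_intros) auto
qed

text \<open>Integrate the vanishing Poisson integrals over the centre \<open>a\<close> in
  \<open>{u..v}\<close> and exchange the integrals; Fubini applies because the kernel integrates to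
  at most pi over \<open>a\<close>.\<close>

lemma Poisson_integral_zero_imp_arctan:
  fixes f :: "real \<Rightarrow> real"
  assumes "finite_measure M" and sM: "sets M = sets borel" and f: "integrable M f"
    and b: "b > 0" and uv: "u \<le> v"
    and zero: "\<And>a. (\<integral>x. f x * (b / ((x - a)^2 + b^2)) \<partial>M) = 0"
  shows "(\<integral>x. f x * (arctan ((v - x) / b) - arctan ((u - x) / b)) \<partial>M) = 0"
proof -
  interpret M: finite_measure M by fact
  interpret pair_sigma_finite M lborel by unfold_locales
  note [measurable_cong] = sM and [measurable] = borel_measurable_integrable[OF f]
  define A where "A x = arctan ((v - x) / b) - arctan ((u - x) / b)" for x
  define K where "K x a = b / ((x - a)^2 + b^2) * indicator {u..v} a" for x a :: real
  note HB = has_bochner_integral_Poisson_kernel[OF b uv, folded K_def A_def]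
  have K0: "0 \<le> K x a" for x a unfolding K_def using b by simp
  have KM: "(\<lambda>p. K (fst p) (snd p)) \<in> borel_measurable (M \<Otimes>\<^sub>M lborel)"
    unfolding K_def by measurable
  have AM: "integrable M (\<lambda>x. f x * A x)"
  proof (rule Bochner_Integration.integrable_bound[OF integrable_mult_left[OF f, of pi]])
    show "(\<lambda>x. f x * A x) \<in> borel_measurable M" unfolding A_def by measurable
    have "\<bar>A x\<bar> \<le> pi" for x
      unfolding A_def using arctan_bounded[of "(v - x) / b"] arctan_bounded[of "(u - x) / b"] by (auto simp: abs_if)
    then show "AE x in M. norm (f x * A x) \<le> norm (f x * pi)"
      by (intro AE_I2) (auto simp: abs_mult intro!: mult_left_mono)
  qed
  have int: "integrable (M \<Otimes>\<^sub>M lborel) (\<lambda>(x, a). f x * K x a)"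
  proof (rule Fubini_integrable)
    show "(\<lambda>(x, a). f x * K x a) \<in> borel_measurable (M \<Otimes>\<^sub>M lborel)"
      unfolding split_beta' using KM by measurable
    have "(\<lambda>x. \<integral>a. norm (case (x, a) of (x, a) \<Rightarrow> f x * K x a) \<partial>lborel) = (\<lambda>x. \<bar>f x\<bar> * A x)"
      using K0 has_bochner_integral_integral_eq[OF HB] by (auto simp: abs_mult fun_eq_iff)
    moreover have "A x \<ge> 0" for x unfolding A_def using uv b by (auto simp: arctan_le_iff divide_right_mono)
    ultimately show "integrable M (\<lambda>x. \<integral>a. norm (case (x, a) of (x, a) \<Rightarrow> f x * K x a) \<partial>lborel)"
      using integrable_abs[OF AM] by (simp add: abs_mult)
    show "AE x in M. integrable lborel (\<lambda>a. case (x, a) of (x, a) \<Rightarrow> f x * K x a)"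
      using HB by (auto simp: has_bochner_integral_iff)
  qed
  have "(\<integral>x. f x * A x \<partial>M) = (\<integral>x. (\<integral>a. f x * K x a \<partial>lborel) \<partial>M)"
    using has_bochner_integral_integral_eq[OF HB] by simp
  also have "\<dots> = (\<integral>a. (\<integral>x. f x * K x a \<partial>M) \<partial>lborel)"
    using Fubini_integral[OF int] by simp
  also have "\<dots> = 0"
  proof -
    have "(\<integral>x. f x * K x a \<partial>M) = (\<integral>x. f x * (b / ((x - a)^2 + b^2)) \<partial>M) * indicator {u..v} a" for a
      unfolding K_def by (simp only: mult.assoc[symmetric] integral_mult_left_zero)
    then show ?thesis using zero by simp
  qed
  finally show ?thesis unfolding A_def .
qed

text \<open>The positive and negative parts of \<open>f\<close> are densities of finite measures
  that agree on all half-lines \<open>{a<..}\<close>, hence coincide.\<close>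

lemma AE_zero_if_integral_greaterThan_zero:
  fixes f :: "real \<Rightarrow> real"
  assumes sM: "sets M = sets borel" and f: "integrable M f"
    and zero: "\<And>a. (\<integral>x. f x * indicator {a<..} x \<partial>M) = 0"
  shows "AE x in M. f x = 0"
proof -
  note [measurable] = borel_measurable_integrable[OF f]
  have [measurable]: "{a<..} \<in> sets M" for a using sM by simp
  \<comment> \<open>\<open>ennreal\<close> sends negative reals to 0, so these are the two parts of
    \<open>f\<close>; the factor \<open>c\<close> below stands for 1 or -1.\<close>
  let ?p = "\<lambda>x. ennreal (f x)" and ?n = "\<lambda>x. ennreal (- f x)"
  have i: "integrable M (\<lambda>x. max 0 (c * f x) * indicator {a<..} x)" for a c
    by (rule Bochner_Integration.integrable_bound[OF integrable_mult_right[OF f, of c]]) (auto simp: indicator_def)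
  have em: "emeasure (density M (\<lambda>x. ennreal (c * f x))) {a<..} = ennreal (\<integral>x. max 0 (c * f x) * indicator {a<..} x \<partial>M)" for a c
  proof -
    have "emeasure (density M (\<lambda>x. ennreal (c * f x))) {a<..} = (\<integral>\<^sup>+x. ennreal (max 0 (c * f x) * indicator {a<..} x) \<partial>M)"
      by (subst emeasure_density) (auto intro!: nn_integral_cong simp: indicator_def ennreal_neg max_def)
    also have "\<dots> = ennreal (\<integral>x. max 0 (c * f x) * indicator {a<..} x \<partial>M)"
      by (rule nn_integral_eq_integral[OF i]) simp
    finally show ?thesis .
  qed
  have "density M ?p = density M ?n"
  proof (rule measure_eqI_lessThan)
    show "sets (density M ?p) = sets borel" "sets (density M ?n) = sets borel" using sM by auto
    fix a
    show "emeasure (density M ?p) {a<..} < \<infinity>" using em[of 1 a] by simp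
    have "(\<integral>x. max 0 (1 * f x) * indicator {a<..} x \<partial>M) - (\<integral>x. max 0 (- 1 * f x) * indicator {a<..} x \<partial>M)
       = (\<integral>x. max 0 (1 * f x) * indicator {a<..} x - max 0 (- 1 * f x) * indicator {a<..} x \<partial>M)"
      by (rule Bochner_Integration.integral_diff[symmetric]) (rule i)+
    also have "\<dots> = (\<integral>x. f x * indicator {a<..} x \<partial>M)"
      by (intro Bochner_Integration.integral_cong) (auto simp: max_def indicator_def)
    finally show "emeasure (density M ?p) {a<..} = emeasure (density M ?n) {a<..}"
      using em[of 1 a] em[of "-1" a] zero by simp
  qed
  moreover have "(\<integral>\<^sup>+x. ennreal (f x) \<partial>M) \<noteq> \<infinity>"
    using f by (metis real_integrable_def infinity_ennreal_def)
  ultimately have "AE x in M. ?p x = ?n x"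
    by (subst (asm) finite_density_unique) auto
  then show ?thesis
  proof eventually_elim
    case (elim x)
    then show ?case
      by (cases "0 \<le> f x") (auto simp: ennreal_neg ennreal_eq_0_iff dest: sym)
  qed
qed

text \<open>Stieltjes inversion. If the transform vanishes off the real axis, its imaginary part
  gives zero Poisson integrals. Integrating these over intervals and letting the height tend to 0
  leads to test functions built from \<open>sgn\<close>, and from them to indicators of
  half-lines.\<close>

lemma Cauchy_transform_nonzero:
  fixes f :: "real \<Rightarrow> real"
  assumes fin: "finite_measure M" and sM: "sets M = sets borel" and f: "integrable M f"
    and nz: "\<not> (AE x in M. f x = 0)"
  shows "\<exists>z. Im z \<noteq> 0 \<and> (\<integral>x. complex_of_real (f x) / (complex_of_real x - z) \<partial>M) \<noteq> 0"
proof (rule ccontr)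
  assume "\<not> ?thesis"
  then have C: "(\<integral>x. complex_of_real (f x) / (complex_of_real x - z) \<partial>M) = 0" if "Im z \<noteq> 0" for z
    using that by blast
  note lim = integral_mult_bounded_limit[OF sM f]
  have Poisson: "(\<integral>x. f x * (b / ((x - a)^2 + b^2)) \<partial>M) = 0" if b: "b > 0" for a b
  proof -
    have "Im (complex_of_real t / (complex_of_real x - Complex a b)) = t * (b / ((x - a)^2 + b^2))" for x t
      by (simp add: Im_divide)
    then have "(\<integral>x. f x * (b / ((x - a)^2 + b^2)) \<partial>M)
        = (\<integral>x. Im (complex_of_real (f x) / (complex_of_real x - Complex a b)) \<partial>M)" by simp
    also have "\<dots> = Im (\<integral>x. complex_of_real (f x) / (complex_of_real x - Complex a b) \<partial>M)"
      using b by (intro integral_Im integrable_Cauchy_kernel sM f) auto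
    finally show ?thesis using C[of "Complex a b"] b by simp
  qed
  \<comment> \<open>The height \<open>b = 1 / real (Suc n)\<close> tends to 0; end points keep half
    weight since \<open>sgn 0 = 0\<close>.\<close>
  have sgn: "(\<integral>x. f x * (pi / 2 * sgn (v - x) - pi / 2 * sgn (u - x)) \<partial>M) = 0" if "u \<le> v" for u v
  proof (rule lim[where C = pi])
    show "(\<lambda>n. arctan ((v - x) * real (Suc n)) - arctan ((u - x) * real (Suc n)))
            \<longlonglongrightarrow> pi / 2 * sgn (v - x) - pi / 2 * sgn (u - x)" for x
      by (intro tendsto_diff tendsto_arctan_sgn)
    show "\<bar>arctan ((v - x) * real (Suc n)) - arctan ((u - x) * real (Suc n))\<bar> \<le> pi" for n x
      using arctan_bounded[of "(v - x) * real (Suc n)"] arctan_bounded[of "(u - x) * real (Suc n)"]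
      by (auto simp: abs_if)
    show "(\<integral>x. f x * (arctan ((v - x) * real (Suc n)) - arctan ((u - x) * real (Suc n))) \<partial>M) = 0" for n
      using Poisson_integral_zero_imp_arctan[OF fin sM f _ that Poisson, of "1 / real (Suc n)"] by simp
  qed measurable
  have gt: "(\<integral>x. f x * indicator {u<..} x \<partial>M) = 0" for u
  proof -
    \<comment> \<open>The right end point \<open>u + real n\<close> goes to infinity.\<close>
    have sgn1: "(\<integral>x. f x * (pi / 2 - pi / 2 * sgn (u - x)) \<partial>M) = 0" for u
    proof (rule lim[where C = pi])
      show "(\<lambda>n. pi / 2 * sgn (u + real n - x) - pi / 2 * sgn (u - x)) \<longlonglongrightarrow> pi / 2 - pi / 2 * sgn (u - x)" for x
      proof (rule tendsto_eventually)
        obtain N where N: "x - u < real N" using reals_Archimedean2 by blast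
        show "\<forall>\<^sub>F n in sequentially. pi / 2 * sgn (u + real n - x) - pi / 2 * sgn (u - x) = pi / 2 - pi / 2 * sgn (u - x)"
          using eventually_ge_at_top[of N]
        proof eventually_elim
          case (elim n)
          then have "u + real n - x > 0" using N by linarith
          then show ?case by simp
        qed
      qed
      show "(\<integral>x. f x * (pi / 2 * sgn (u + real n - x) - pi / 2 * sgn (u - x)) \<partial>M) = 0" for n
        by (rule sgn) simp
    qed (auto simp: sgn_if)
    \<comment> \<open>Approaching \<open>u\<close> from the right removes the half weight at
      \<open>u\<close>.\<close>
    have "(\<integral>x. f x * (pi * indicator {u<..} x) \<partial>M) = 0"
    proof (rule lim[where C = pi])
      show "(\<integral>x. f x * (pi / 2 - pi / 2 * sgn (u + 1 / real (Suc n) - x)) \<partial>M) = 0" for n by (rule sgn1)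
      show "(\<lambda>n. pi / 2 - pi / 2 * sgn (u + 1 / real (Suc n) - x)) \<longlonglongrightarrow> pi * indicator {u<..} x" for x
      proof (rule tendsto_eventually)
        have lim0: "(\<lambda>n. u + 1 / real (Suc n) - x) \<longlonglongrightarrow> u + 0 - x"
          by (intro tendsto_intros LIMSEQ_Suc[OF lim_1_over_n])
        show "\<forall>\<^sub>F n in sequentially. pi / 2 - pi / 2 * sgn (u + 1 / real (Suc n) - x) = pi * indicator {u<..} x"
        proof (cases "x \<le> u")
          case True
          then have "u + 1 / real (Suc n) - x > 0" for n 
            using of_nat_0_less_iff[of "Suc n", where 'a = real] by (smt (verit) divide_pos_pos zero_less_Suc)
          then show ?thesis using True by simp
        next
          case False
          then have "\<forall>\<^sub>F n in sequentially. u + 1 / real (Suc n) - x < 0"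
            by (intro order_tendstoD(2)[OF lim0]) simp
          then show ?thesis by eventually_elim (use False in simp)
        qed
      qed
    qed (auto simp: sgn_if)
    then show ?thesis by (simp add: mult.left_commute[of _ pi])
  qed
  then show False using AE_zero_if_integral_greaterThan_zero[OF sM f] nz by blast
qed

section \<open>A second solution from an annihilator of the polynomials\<close>

lemma finite_measure_if_integrable_one:
  assumes "integrable M (\<lambda>_. 1 :: real)"
  shows "finite_measure M"
  using assms by (intro finite_measureI) (auto simp: integrable_iff_bounded)

lemma abs_mult_le_sum_squares:
  fixes a b :: real
  shows "\<bar>a * b\<bar> \<le> a^2 + b^2"
proof -
  have "2 * (a * b) \<le> a^2 + b^2" "- (2 * (a * b)) \<le> a^2 + b^2"
    using sum_squares_bound[of a b] sum_squares_bound[of a "- b"] by simp_all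
  then show ?thesis by linarith
qed

lemma Cauchy_Schwarz_integral:
  fixes f g :: "'a \<Rightarrow> real"
  assumes [measurable]: "f \<in> borel_measurable M" "g \<in> borel_measurable M"
    and f: "integrable M (\<lambda>x. (f x)^2)" and g: "integrable M (\<lambda>x. (g x)^2)"
  shows "(\<integral>x. \<bar>f x * g x\<bar> \<partial>M)^2 \<le> (\<integral>x. (f x)^2 \<partial>M) * (\<integral>x. (g x)^2 \<partial>M)"
proof -
  have fg: "integrable M (\<lambda>x. \<bar>f x * g x\<bar>)"
  proof (rule Bochner_Integration.integrable_bound[OF Bochner_Integration.integrable_add[OF f g]])
    show "AE x in M. norm \<bar>f x * g x\<bar> \<le> norm ((f x)^2 + (g x)^2)"
      using abs_mult_le_sum_squares[of "f _" "g _"] by (auto intro: order.trans[OF _ abs_ge_self])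
  qed simp
  have "(\<integral>\<^sup>+x. ennreal \<bar>f x\<bar> * ennreal \<bar>g x\<bar> \<partial>M)^2
      \<le> (\<integral>\<^sup>+x. ennreal \<bar>f x\<bar> ^ 2 \<partial>M) * (\<integral>\<^sup>+x. ennreal \<bar>g x\<bar> ^ 2 \<partial>M)"
    by (rule Cauchy_Schwarz_nn_integral) measurable
  moreover have "(\<integral>\<^sup>+x. ennreal \<bar>f x\<bar> * ennreal \<bar>g x\<bar> \<partial>M) = ennreal (\<integral>x. \<bar>f x * g x\<bar> \<partial>M)"
    using nn_integral_eq_integral[OF fg] by (simp add: abs_mult ennreal_mult)
  moreover have "(\<integral>\<^sup>+x. ennreal \<bar>f x\<bar> ^ 2 \<partial>M) = ennreal (\<integral>x. (f x)^2 \<partial>M)"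
    using nn_integral_eq_integral[OF f] by (simp add: ennreal_power)
  moreover have "(\<integral>\<^sup>+x. ennreal \<bar>g x\<bar> ^ 2 \<partial>M) = ennreal (\<integral>x. (g x)^2 \<partial>M)"
    using nn_integral_eq_integral[OF g] by (simp add: ennreal_power)
  ultimately show ?thesis
    by (simp add: ennreal_power flip: ennreal_mult)
qed

text \<open>Induction by x^(k+1) / (x - z) = x^k + z x^k / (x - z), where the first term integrates
  to zero against \<open>f\<close>.\<close>

lemma annihilator_Cauchy_transform_power:
  fixes f :: "real \<Rightarrow> real"
  assumes sM: "sets M = sets borel" and int: "\<And>k. integrable M (\<lambda>x. x ^ k * f x)"
    and zero: "\<And>k. (\<integral>x. x ^ k * f x \<partial>M) = 0" and z: "Im z \<noteq> 0"
  shows "(\<integral>x. complex_of_real (x ^ k * f x) / (complex_of_real x - z) \<partial>M)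
       = z ^ k * (\<integral>x. complex_of_real (f x) / (complex_of_real x - z) \<partial>M)"
proof (induction k)
  case (Suc k)
  have ne: "complex_of_real x - z \<noteq> 0" for x using z by (auto simp: complex_eq_iff)
  have "complex_of_real (x ^ Suc k * f x) / (complex_of_real x - z)
      = complex_of_real (x ^ k * f x) + z * (complex_of_real (x ^ k * f x) / (complex_of_real x - z))" for x
    using ne[of x] by (simp add: field_simps)
  then have "(\<integral>x. complex_of_real (x ^ Suc k * f x) / (complex_of_real x - z) \<partial>M)
     = (\<integral>x. complex_of_real (x ^ k * f x) + z * (complex_of_real (x ^ k * f x) / (complex_of_real x - z)) \<partial>M)"
    by simp
  also have "\<dots> = complex_of_real (\<integral>x. x ^ k * f x \<partial>M) + z * (\<integral>x. complex_of_real (x ^ k * f x) / (complex_of_real x - z) \<partial>M)"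
    using int[of k] integrable_Cauchy_kernel[OF sM int z, of k]
    by (subst Bochner_Integration.integral_add) (auto simp del: of_real_mult of_real_power times_divide_eq_right)
  finally show ?case using Suc.IH zero[of k] by (simp del: of_real_mult of_real_power)
qed simp

text \<open>By linearity p(z) F is the integral of p f / (x - z). Cauchy-Schwarz, with 1 / |x - z|
  put on the side of the polynomial, bounds evaluation at \<open>z\<close> by the norm of L^2(M /
  w).\<close>

lemma annihilator_evaluation_bound:
  fixes f :: "real \<Rightarrow> real" and z :: complex and M :: "real measure"
  defines "w \<equiv> (\<lambda>x. (x - Re z)^2 + (Im z)^2)"
    and "F \<equiv> (\<integral>x. complex_of_real (f x) / (complex_of_real x - z) \<partial>M)"
  assumes sM: "sets M = sets borel" and mom: "\<And>k. integrable M (\<lambda>x. x ^ k)"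
    and f [measurable]: "f \<in> borel_measurable borel" and f2: "integrable M (\<lambda>x. (f x)^2)"
    and zero: "\<And>k. (\<integral>x. x ^ k * f x \<partial>M) = 0" and z: "Im z \<noteq> 0"
    and w: "\<And>k. integrable M (\<lambda>x. x ^ k / w x)"
  shows "(norm (\<Sum>i\<le>n. complex_of_real (c i) * z ^ i) * norm F)^2
      \<le> (\<integral>x. (\<Sum>i\<le>n. c i * x ^ i)^2 / w x \<partial>M) * (\<integral>x. (f x)^2 \<partial>M)"
proof -
  note [measurable_cong] = sM
  define p where "p x = (\<Sum>i\<le>n. c i * x ^ i)" for x
  have [measurable]: "p \<in> borel_measurable borel" unfolding p_def by measurable
  have w0: "0 < w x" for x unfolding w_def using z by (simp add: add_nonneg_pos)
  have [measurable]: "w \<in> borel_measurable borel" unfolding w_def by measurable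
  have int: "integrable M (\<lambda>x. x ^ k * f x)" for k
  proof (rule Bochner_Integration.integrable_bound[OF Bochner_Integration.integrable_add[OF mom[of "2 * k"] f2]])
    have "\<bar>x ^ k * f x\<bar> \<le> x ^ (2 * k) + (f x)^2" for x
      using abs_mult_le_sum_squares[of "x ^ k" "f x"] by (simp only: power_even_eq)
    then show "AE x in M. norm (x ^ k * f x) \<le> norm (x ^ (2 * k) + (f x)^2)"
      by (intro AE_I2) (simp only: real_norm_def order.trans[OF _ abs_ge_self])
  qed measurable
  have nw: "(norm (complex_of_real x - z))^2 = w x" for x
    unfolding w_def cmod_power2 by simp
  have p2: "integrable M (\<lambda>x. (p x / sqrt (w x))^2)"
  proof -
    have "(p x / sqrt (w x))^2 = (\<Sum>i\<le>n. \<Sum>j\<le>n. c i * c j * (x ^ (i + j) / w x))" for x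
      using w0[of x] unfolding p_def
      by (simp add: power_divide power2_eq_square[of "sum _ _"] sum_product sum_divide_distrib power_add algebra_simps)
    then show ?thesis using w by (simp del: times_divide_eq_right)
  qed
  have "(\<Sum>i\<le>n. complex_of_real (c i) * z ^ i) * F
      = (\<Sum>i\<le>n. complex_of_real (c i) * (\<integral>x. complex_of_real (x ^ i * f x) / (complex_of_real x - z) \<partial>M))"
    unfolding annihilator_Cauchy_transform_power[OF sM int zero z] F_def by (simp add: sum_distrib_right mult.assoc)
  also have "\<dots> = (\<integral>x. (\<Sum>i\<le>n. complex_of_real (c i) * (complex_of_real (x ^ i * f x) / (complex_of_real x - z))) \<partial>M)"
    using integrable_Cauchy_kernel[OF sM int z]
    by (subst Bochner_Integration.integral_sum) (auto simp del: of_real_mult of_real_power times_divide_eq_right)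
  also have "\<dots> = (\<integral>x. complex_of_real (p x * f x) / (complex_of_real x - z) \<partial>M)"
    unfolding p_def by (intro Bochner_Integration.integral_cong) (auto simp: sum_divide_distrib sum_distrib_right mult.assoc)
  finally have "norm (\<Sum>i\<le>n. complex_of_real (c i) * z ^ i) * norm F
      = norm (\<integral>x. complex_of_real (p x * f x) / (complex_of_real x - z) \<partial>M)"
        by (simp add: norm_mult[symmetric])
  also have "\<dots> \<le> (\<integral>x. norm (complex_of_real (p x * f x) / (complex_of_real x - z)) \<partial>M)"
    by (rule integral_norm_bound)
  also have "\<dots> = (\<integral>x. \<bar>p x / sqrt (w x) * f x\<bar> \<partial>M)"
    by (intro Bochner_Integration.integral_cong) (simp_all add: norm_divide norm_mult abs_mult flip: nw)
  finally have "(norm (\<Sum>i\<le>n. complex_of_real (c i) * z ^ i) * norm F)^2 \<le> (\<integral>x. \<bar>p x / sqrt (w x) * f x\<bar> \<partial>M)^2"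
    by (intro power_mono) auto
  also have "\<dots> \<le> (\<integral>x. (p x / sqrt (w x))^2 \<partial>M) * (\<integral>x. (f x)^2 \<partial>M)"
    using p2 f2 by (intro Cauchy_Schwarz_integral) auto
  also have "(\<integral>x. (p x / sqrt (w x))^2 \<partial>M) = (\<integral>x. (p x)^2 / w x \<partial>M)"
    using w0 by (simp add: power_divide less_imp_le)
  finally show ?thesis unfolding p_def .
qed

theorem annihilator_imp_other_solution:
  assumes M: "moment_solution s M"
    and f [measurable]: "f \<in> borel_measurable borel" and f2: "integrable M (\<lambda>x. (f x)^2)"
    and zero: "\<And>k. (\<integral>x. x ^ k * f x \<partial>M) = 0" and nz: "\<not> (AE x in M. f x = 0)"
  shows "\<exists>N. moment_solution s N \<and> N \<noteq> M"
proof -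
  have sM [measurable_cong]: "sets M = sets borel" and fin: "finite_measure M"
    and mom: "\<And>k. integrable M (\<lambda>x. x ^ k)" and s: "\<And>k. (\<integral>x. x ^ k \<partial>M) = s k"
    using M unfolding moment_solution_def by auto
  interpret finite_measure M by (rule fin)
  have f1: "integrable M f"
  proof (rule Bochner_Integration.integrable_bound)
    show "integrable M (\<lambda>x. 1 + (f x)^2)" using f2 by simp
    have "\<bar>f x\<bar> \<le> 1 + (f x)^2" for x
      using abs_power_le_one_plus_even_power[of 1 1 "f x"] by simp
    then show "AE x in M. norm (f x) \<le> norm (1 + (f x)^2)" by (simp add: order.trans[OF _ abs_ge_self])
  qed measurable
  obtain z where z: "Im z \<noteq> 0" and F0: "(\<integral>x. complex_of_real (f x) / (complex_of_real x - z) \<partial>M) \<noteq> 0"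
    using Cauchy_transform_nonzero[OF fin sM f1 nz] by blast
  define F where "F = (\<integral>x. complex_of_real (f x) / (complex_of_real x - z) \<partial>M)"
  define w where "w x = (x - Re z)^2 + (Im z)^2" for x
  have w0: "0 < w x" for x unfolding w_def using z by (simp add: add_nonneg_pos)
  have [measurable]: "w \<in> borel_measurable borel" unfolding w_def by measurable
  have intw: "integrable M (\<lambda>x. x ^ k / w x)" for k
  proof (rule Bochner_Integration.integrable_bound)
    show "integrable M (\<lambda>x. x ^ k / (Im z)^2)" using mom by simp
    have "norm (x ^ k / w x) \<le> norm (x ^ k / (Im z)^2)" for x
      using w0[of x] z by (auto simp: w_def power_abs intro!: divide_left_mono)
    then show "AE x in M. norm (x ^ k / w x) \<le> norm (x ^ k / (Im z)^2)" by simp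
  qed measurable
  \<comment> \<open>\<open>I\<close> is the moment sequence of \<open>M / w\<close>, and
    \<open>C\<close> the constant that bounds |p(z)|^2 by \<open>C\<close> times the integral of p^2
    / w.\<close>
  define I where "I k = (\<integral>x. x ^ k / w x \<partial>M)" for k
  define C where "C = (\<integral>x. (f x)^2 \<partial>M) / (norm F)^2"
  have C0: "0 \<le> C" unfolding C_def by simp
  have sq_I: "(\<integral>x. (\<Sum>i\<le>n. c i * x ^ i)^2 / w x \<partial>M) = (\<Sum>i\<le>n. \<Sum>j\<le>n. c i * c j * I (i + j))" for c :: "nat \<Rightarrow> real" and n
  proof -
    have "(\<Sum>i\<le>n. c i * x ^ i)^2 / w x = (\<Sum>i\<le>n. \<Sum>j\<le>n. c i * c j * (x ^ (i + j) / w x))" for x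
      by (simp add: power2_eq_square sum_product sum_divide_distrib power_add algebra_simps)
    then show ?thesis using intw by (simp add: I_def del: times_divide_eq_right)
  qed
  have bound: "(norm (\<Sum>i\<le>n. complex_of_real (c i) * z ^ i))^2 \<le> C * (\<Sum>i\<le>n. \<Sum>j\<le>n. c i * c j * I (i + j))" for c n
    using annihilator_evaluation_bound[OF sM mom f f2 zero z, folded F_def w_def, OF intw, of c n] F0
    unfolding sq_I C_def F_def[symmetric] by (simp add: power_mult_distrib field_simps)
  \<comment> \<open>With \<open>\<epsilon> * C \<le> 1 / 2\<close> the perturbation uses up at most
    half of the Hankel form of \<open>I\<close>; \<open>C + 1\<close> in place of \<open>C\<close>
    keeps the denominator away from 0.\<close>
  define \<epsilon> where "\<epsilon> = 1 / (2 * (C + 1))"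
  have \<epsilon>: "0 < \<epsilon>" "\<epsilon> * C \<le> 1 / 2"
    unfolding \<epsilon>_def using C0 by (auto simp: field_simps)
  define s' where "s' k = I k - \<epsilon> * Re (z ^ k)" for k
  have pos: "(\<Sum>i\<le>n. \<Sum>j\<le>n. c i * c j * I (i + j)) / 2 \<le> (\<Sum>i\<le>n. \<Sum>j\<le>n. c i * c j * s' (i + j))" for c n
  proof -
    let ?Q = "\<Sum>i\<le>n. \<Sum>j\<le>n. c i * c j * I (i + j)"
    let ?P = "\<Sum>i\<le>n. complex_of_real (c i) * z ^ i"
    have Q0: "0 \<le> ?Q" unfolding sq_I[symmetric] using w0 by (intro integral_nonneg_AE) (auto simp: less_imp_le)
    \<comment> \<open>For real \<open>c\<close> the Hankel form of \<open>Re (z ^ k)\<close> is Re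
      (p(z)^2), at most |p(z)|^2.\<close>
    have "?P^2 = (\<Sum>i\<le>n. \<Sum>j\<le>n. complex_of_real (c i * c j) * z ^ (i + j))"
      by (simp add: power2_eq_square sum_product power_add algebra_simps)
    then have "(\<Sum>i\<le>n. \<Sum>j\<le>n. c i * c j * Re (z ^ (i + j))) = Re (?P^2)" by (simp del: of_real_mult)
    then have "(\<Sum>i\<le>n. \<Sum>j\<le>n. c i * c j * s' (i + j)) = ?Q - \<epsilon> * Re (?P^2)"
      unfolding s'_def by (simp add: right_diff_distrib sum_subtractf sum_distrib_left mult.left_commute flip: \<open>_ = Re (?P^2)\<close>)
    moreover have "\<epsilon> * Re (?P^2) \<le> \<epsilon> * (C * ?Q)"
      using complex_Re_le_cmod[of "?P^2"] bound[of c n] \<epsilon> by (intro mult_left_mono) (auto simp: norm_power)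
    moreover have "\<epsilon> * C * ?Q \<le> 1 / 2 * ?Q" using \<epsilon> Q0 by (intro mult_right_mono)
    ultimately show ?thesis by (simp add: mult.assoc)
  qed
  have "positive_seq s'"
    unfolding positive_seq_def
  proof (intro allI)
    fix n :: nat and c :: "nat \<Rightarrow> real"
    have "0 \<le> (\<Sum>i\<le>n. \<Sum>j\<le>n. c i * c j * I (i + j))"
      unfolding sq_I[symmetric] using w0 by (intro integral_nonneg_AE) (auto simp: less_imp_le)
    then show "0 \<le> (\<Sum>i\<le>n. \<Sum>j\<le>n. c i * c j * s' (i + j))"
      using pos[where n = n and c = c] by linarith
  qed
  \<comment> \<open>The evaluation bound for the constant polynomial 1 forces
    \<open>0 < I 0\<close>, and half of it survives the perturbation.\<close>
  moreover have "0 < s' 0"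
  proof -
    have "1 \<le> C * I 0" using bound[of "\<lambda>_. 1" 0] by simp
    then have "0 < I 0"
      using C0 by (metis less_le_trans zero_less_one zero_less_mult_pos less_eq_real_def mult_zero_left)
    then show ?thesis using pos[where n = 0 and c = "\<lambda>_. 1"] by simp
  qed
  ultimately obtain R where R: "moment_solution s' R" using Hamburger_moment_existence by blast
  have sR [measurable_cong]: "sets R = sets borel"
    and momR: "\<And>k. integrable R (\<lambda>x. x ^ k)" and s'R: "\<And>k. (\<integral>x. x ^ k \<partial>R) = s' k"
    using R unfolding moment_solution_def by auto
  \<comment> \<open>Expansion of (x - z)(x - cnj z) x^k in powers of \<open>x\<close>.\<close>
  have w_expand: "w x * x ^ k = x ^ (k + 2) - 2 * Re z * x ^ (k + 1) + (norm z)^2 * x ^ k" for x k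
    unfolding w_def cmod_power2 by (simp add: power2_eq_square algebra_simps)
  define N where "N = density R (\<lambda>x. ennreal (w x))"
  have intN: "integrable N (\<lambda>x. x ^ k)" and momN: "(\<integral>x. x ^ k \<partial>N) = s k" for k
  proof -
    have iR: "integrable R (\<lambda>x. w x * x ^ k)"
      unfolding w_expand using momR by (intro Bochner_Integration.integrable_add Bochner_Integration.integrable_diff integrable_mult_right)
    then show "integrable N (\<lambda>x. x ^ k)"
      unfolding N_def using w0 by (subst integrable_density) (auto simp: less_imp_le)
    have "(\<integral>x. x ^ k \<partial>N) = (\<integral>x. w x * x ^ k \<partial>R)"
      unfolding N_def using w0 by (subst integral_density) (auto simp: less_imp_le)
    also have "\<dots> = s' (k + 2) - 2 * Re z * s' (k + 1) + (norm z)^2 * s' k"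
      unfolding w_expand using momR by (simp add: s'R del: power_Suc)
    also have "\<dots> = (I (k + 2) - 2 * Re z * I (k + 1) + (norm z)^2 * I k)
        - \<epsilon> * (Re (z ^ (k + 2)) - 2 * Re z * Re (z ^ (k + 1)) + (norm z)^2 * Re (z ^ k))"
      unfolding s'_def by (simp add: algebra_simps)
    \<comment> \<open>\<open>z\<close> is a root of the quadratic polynomial \<open>w\<close>, so
      multiplication by \<open>w\<close> removes the perturbation.\<close>
    also have "Re (z ^ (k + 2)) - 2 * Re z * Re (z ^ (k + 1)) + (norm z)^2 * Re (z ^ k) = 0"
      unfolding cmod_power2 by (simp add: power2_eq_square algebra_simps)
    also have "I (k + 2) - 2 * Re z * I (k + 1) + (norm z)^2 * I k = (\<integral>x. x ^ (k + 2) / w x - 2 * Re z * (x ^ (k + 1) / w x) + (norm z)^2 * (x ^ k / w x) \<partial>M)"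
      unfolding I_def using intw by (simp del: power_Suc times_divide_eq_right)
    also have "\<dots> = (\<integral>x. x ^ k \<partial>M)"
    proof (intro Bochner_Integration.integral_cong refl)
      fix x
      have "x ^ (k + 2) / w x - 2 * Re z * (x ^ (k + 1) / w x) + (norm z)^2 * (x ^ k / w x) = (w x * x ^ k) / w x"
        unfolding w_expand by (simp only: add_divide_distrib diff_divide_distrib times_divide_eq_right)
      then show "x ^ (k + 2) / w x - 2 * Re z * (x ^ (k + 1) / w x) + (norm z)^2 * (x ^ k / w x) = x ^ k"
        using w0[of x] by simp
    qed
    finally show "(\<integral>x. x ^ k \<partial>N) = s k" by (simp add: s)
  qed
  have "finite_measure N"
    using intN[of 0] by (intro finite_measure_if_integrable_one) simp
  then have "moment_solution s N"
    unfolding moment_solution_def using intN momN by (simp add: N_def sR)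
  \<comment> \<open>If \<open>N = M\<close>, division by \<open>w\<close> would give equal masses;
    but \<open>R\<close> has mass \<open>s' 0 = I 0 - \<epsilon>\<close>, as
    \<open>Re (z ^ 0) = 1\<close>.\<close>
  moreover have "N \<noteq> M"
  proof
    assume "N = M"
    then have "I 0 = (\<integral>x. 1 / w x \<partial>N)" by (simp add: I_def)
    also have "\<dots> = (\<integral>x. w x * (1 / w x) \<partial>R)"
      unfolding N_def using w0 by (subst integral_density) (auto simp: less_imp_le)
    also have "\<dots> = s' 0" using w0 s'R[of 0] by (simp add: less_imp_neq[symmetric])
    finally show False using \<epsilon> by (simp add: s'_def)
  qed
  ultimately show ?thesis by blast
qed

section \<open>Subsequences of indeterminate sequences\<close>

lemma moment_solutionD:
  assumes "moment_solution s M"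
  shows "sets M = sets borel" "finite_measure M" "integrable M (\<lambda>x. x ^ k)" "(\<integral>x. x ^ k \<partial>M) = s k"
  using assms unfolding moment_solution_def by auto

lemma positive_seq_if_moment_solution:
  assumes M: "moment_solution s M"
  shows "positive_seq s"
  unfolding positive_seq_def
proof (intro allI)
  fix n :: nat and c :: "nat \<Rightarrow> real"
  note D = moment_solutionD[OF M]
  have "0 \<le> (\<integral>x. (\<Sum>i\<le>n. c i * x ^ i)^2 \<partial>M)" by (rule integral_nonneg_AE) simp
  also have "\<dots> = (\<integral>x. (\<Sum>i\<le>n. \<Sum>j\<le>n. c i * c j * x ^ (i + j)) \<partial>M)"
    by (intro Bochner_Integration.integral_cong refl)
       (simp add: power2_eq_square sum_product power_add algebra_simps)
  also have "\<dots> = (\<Sum>i\<le>n. \<Sum>j\<le>n. c i * c j * s (i + j))" using D(3,4) by simp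
  finally show "0 \<le> (\<Sum>i\<le>n. \<Sum>j\<le>n. c i * c j * s (i + j))" .
qed

text \<open>Any solution forces positivity, so each reduction only has to carry two different
  solutions along.\<close>

lemma indeterminate_iff_two_solutions:
  "indeterminate s \<longleftrightarrow> (\<exists>M N. moment_solution s M \<and> moment_solution s N \<and> M \<noteq> N)"
  unfolding indeterminate_def determinate_def using positive_seq_if_moment_solution by blast

lemma moment_solution_distr_power:
  assumes M: "moment_solution s M"
  shows "moment_solution (\<lambda>k. s (k * d)) (distr M borel (\<lambda>x. x ^ d))"
proof -
  note D = moment_solutionD[OF M]
  note [measurable_cong] = D(1)
  have m: "(\<lambda>x. x ^ d) \<in> borel_measurable M" by measurable
  have "finite_measure (distr M borel (\<lambda>x. x ^ d))" by (rule finite_measure.finite_measure_distr[OF D(2) m])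
  moreover have "(x ^ d) ^ k = x ^ (k * d)" for x :: real and k by (simp add: power_mult[symmetric] mult.commute)
  ultimately show ?thesis
    unfolding moment_solution_def using D(3,4) m by (auto simp: integrable_distr_eq integral_distr)
qed

text \<open>An odd power is a bijection of the real line with measurable inverse
  \<open>root d\<close>, so the push-forward loses nothing.\<close>

lemma indeterminate_odd_power:
  assumes "indeterminate s" "odd d"
  shows "indeterminate (\<lambda>k. s (k * d))"
proof -
  obtain M N where MN: "moment_solution s M" "moment_solution s N" "M \<noteq> N"
    using assms(1) unfolding indeterminate_iff_two_solutions by blast
  have inv: "distr (distr L borel (\<lambda>x. x ^ d)) borel (root d) = L" if "sets L = sets borel" for L :: "real measure"
  proof -
    note [measurable_cong] = that
    have "distr (distr L borel (\<lambda>x. x ^ d)) borel (root d) = distr L borel (\<lambda>x. x)"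
      using assms(2) by (subst distr_distr) (auto simp: o_def odd_real_root_power_cancel)
    also have "\<dots> = L" by (rule distr_id2[OF that[symmetric]])
    finally show ?thesis .
  qed
  then have "distr M borel (\<lambda>x. x ^ d) \<noteq> distr N borel (\<lambda>x. x ^ d)"
    using MN(3) moment_solutionD(1)[OF MN(1)] moment_solutionD(1)[OF MN(2)] by metis
  then show ?thesis
    unfolding indeterminate_iff_two_solutions using MN(1,2)[THEN moment_solution_distr_power] by blast
qed

lemma moment_solution_density_power:
  assumes M: "moment_solution s M" and l: "even l"
  shows "moment_solution (\<lambda>k. s (k + l)) (density M (\<lambda>x. ennreal (x ^ l)))"
proof -
  note D = moment_solutionD[OF M]
  note [measurable_cong] = D(1)
  have mom: "integrable (density M (\<lambda>x. ennreal (x ^ l))) (\<lambda>x. x ^ k)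
      \<and> (\<integral>x. x ^ k \<partial>density M (\<lambda>x. ennreal (x ^ l))) = s (k + l)" for k
    using D(3)[of "k + l"] D(4)[of "k + l"] l
    by (simp add: integrable_density integral_density zero_le_even_power power_add mult.commute)
  have "finite_measure (density M (\<lambda>x. ennreal (x ^ l)))"
    using mom[of 0] by (intro finite_measure_if_integrable_one) simp
  then show ?thesis unfolding moment_solution_def using mom D(1) by simp
qed

text \<open>Both total masses equal \<open>s 0\<close>, so agreement away from 0 fixes the atom at
  0, which a weight vanishing at 0 would hide.\<close>

lemma moment_solution_eqI_punctured:
  assumes M: "moment_solution s M" and N: "moment_solution s N"
    and eq: "\<And>A. A \<in> sets borel \<Longrightarrow> 0 \<notin> A \<Longrightarrow> emeasure M A = emeasure N A"
  shows "M = N"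
proof -
  note DM = moment_solutionD[OF M] and DN = moment_solutionD[OF N]
  interpret M: finite_measure M by (rule DM)
  interpret N: finite_measure N by (rule DN)
  have sp: "space M = UNIV" "space N = UNIV" using DM(1) DN(1) by (metis sets_eq_imp_space_eq space_borel)+
  have "measure M UNIV = measure N UNIV" using DM(4)[of 0] DN(4)[of 0] sp by simp
  moreover have "measure M (UNIV - {0}) = measure N (UNIV - {0})" using eq[of "UNIV - {0}"] by (simp add: measure_def)
  ultimately have 0: "measure M {0} = measure N {0}"
    using M.finite_measure_compl[of "{0}"] N.finite_measure_compl[of "{0}"] DM(1) DN(1) sp by simp
  show ?thesis
  proof (rule measure_eqI)
    show "sets M = sets N" using DM(1) DN(1) by simp
    fix A assume "A \<in> sets M"
    then have A: "A \<in> sets borel" using DM(1) by simp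
    have *: "emeasure L A = emeasure L (A - {0}) + emeasure L (A \<inter> {0})" if "sets L = sets borel" for L :: "real measure"
      using A that by (subst plus_emeasure) (auto intro!: arg_cong[of _ _ "emeasure L"])
    have "emeasure M (A \<inter> {0}) = emeasure N (A \<inter> {0})"
      using 0 by (cases "0 \<in> A") (auto simp: M.emeasure_eq_measure N.emeasure_eq_measure)
    then show "emeasure M A = emeasure N A" using * DM(1) DN(1) eq[of "A - {0}"] A by simp
  qed
qed

lemma indeterminate_even_shift:
  assumes "indeterminate s" "even l"
  shows "indeterminate (\<lambda>k. s (k + l))"
proof -
  obtain M N where MN: "moment_solution s M" "moment_solution s N" "M \<noteq> N"
    using assms(1) unfolding indeterminate_iff_two_solutions by blast
  have "density M (\<lambda>x. ennreal (x ^ l)) \<noteq> density N (\<lambda>x. ennreal (x ^ l))"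
  proof
    assume eq: "density M (\<lambda>x. ennreal (x ^ l)) = density N (\<lambda>x. ennreal (x ^ l))"
    \<comment> \<open>Dividing by the weight recovers \<open>L\<close> on sets that avoid 0, where
      \<open>x ^ l\<close> is strictly positive.\<close>
    have rec: "emeasure L A = (\<integral>\<^sup>+x. ennreal (1 / x ^ l) * indicator A x \<partial>density L (\<lambda>x. ennreal (x ^ l)))"
      if "sets L = sets borel" "A \<in> sets borel" "0 \<notin> A" for L :: "real measure" and A
    proof -
      note [measurable_cong] = that(1)
      note [measurable] = that(2)
      have "(\<integral>\<^sup>+x. ennreal (1 / x ^ l) * indicator A x \<partial>density L (\<lambda>x. ennreal (x ^ l)))
          = (\<integral>\<^sup>+x. ennreal (x ^ l) * (ennreal (1 / x ^ l) * indicator A x) \<partial>L)"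
        by (rule nn_integral_density) measurable
      also have "\<dots> = (\<integral>\<^sup>+x. indicator A x \<partial>L)"
      proof (rule nn_integral_cong)
        fix x
        show "ennreal (x ^ l) * (ennreal (1 / x ^ l) * indicator A x) = indicator A x"
        proof (cases "x \<in> A")
          case True
          then have "x \<noteq> 0" using that(3) by auto
          then have "ennreal (x ^ l) * ennreal (1 / x ^ l) = 1"
            using assms(2) by (simp add: zero_le_even_power flip: ennreal_mult)
          then show ?thesis by (simp add: mult.assoc[symmetric])
        qed simp
      qed
      finally show ?thesis using that by simp
    qed
    have "M = N"
    proof (rule moment_solution_eqI_punctured[OF MN(1,2)])
      fix A :: "real set" assume "A \<in> sets borel" "0 \<notin> A"
      then show "emeasure M A = emeasure N A"
        using rec[of M A] rec[of N A] eq moment_solutionD(1)[OF MN(1)] moment_solutionD(1)[OF MN(2)] by simp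
    qed
    then show False using MN(3) by simp
  qed
  then show ?thesis
    unfolding indeterminate_iff_two_solutions
    using MN(1,2)[THEN moment_solution_density_power, OF assms(2)] by blast
qed

section \<open>Squaring: densities for the image of the positive half-line\<close>

lemma density_of_dominated_measure:
  assumes "finite_measure M" and sets: "sets N = sets M"
    and le: "\<And>A. A \<in> sets M \<Longrightarrow> emeasure N A \<le> emeasure M A"
  shows "\<exists>g :: 'a \<Rightarrow> real. g \<in> borel_measurable M \<and> (\<forall>x. 0 \<le> g x \<and> g x \<le> 1) \<and> N = density M (\<lambda>x. ennreal (g x))"
proof -
  interpret finite_measure M by fact
  have "absolutely_continuous M N"
    unfolding absolutely_continuous_def
  proof
    fix A assume A: "A \<in> null_sets M"
    then have "emeasure N A \<le> 0" using le[of A] by (simp add: null_sets_def)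
    then show "A \<in> null_sets N" using A sets by (simp add: null_sets_def)
  qed
  then obtain G where G [measurable]: "G \<in> borel_measurable M" and N: "density M G = N"
    using Radon_Nikodym sets by blast
  \<comment> \<open>Truncating the density at 1 does not change \<open>N\<close>, because \<open>N \<le> M\<close> on the set where \<open>G > 1\<close>.\<close>
  define g where "g x = enn2real (min (G x) 1)" for x
  have g: "ennreal (g x) = min (G x) 1" for x
    unfolding g_def by (rule ennreal_enn2real) (simp add: min_less_iff_disj)
  have [measurable]: "g \<in> borel_measurable M" unfolding g_def by measurable
  have "0 \<le> g x \<and> g x \<le> 1" for x
    unfolding g_def by (auto intro: enn2real_leI)
  moreover have "N = density M (\<lambda>x. ennreal (g x))"
  proof (rule measure_eqI)
    fix A assume "A \<in> sets N"
    then have [measurable]: "A \<in> sets M" using sets by simp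
    define B where "B = {x \<in> space M. x \<in> A \<and> 1 < G x}"
    have [measurable]: "B \<in> sets M" unfolding B_def by measurable
    have BA: "B \<subseteq> A" unfolding B_def by auto
    have "emeasure N A = emeasure N (A - B) + emeasure N B"
      using BA sets by (subst plus_emeasure) (auto intro!: arg_cong[of _ _ "emeasure N"])
    also have "\<dots> \<le> emeasure N (A - B) + emeasure M B" using le by (intro add_left_mono) simp
    also have "emeasure N (A - B) = emeasure (density M (\<lambda>x. ennreal (g x))) (A - B)"
      unfolding N[symmetric] by (simp add: emeasure_density)
         (auto intro!: nn_integral_cong simp: g B_def indicator_def min_def)
    also have "emeasure M B = emeasure (density M (\<lambda>x. ennreal (g x))) B"
    proof -
      have "emeasure M B = (\<integral>\<^sup>+x. indicator B x \<partial>M)" by simp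
      also have "\<dots> = (\<integral>\<^sup>+x. ennreal (g x) * indicator B x \<partial>M)"
        by (intro nn_integral_cong) (auto simp: g B_def indicator_def min_def)
      finally show ?thesis by (simp add: emeasure_density)
    qed
    also have "emeasure (density M (\<lambda>x. ennreal (g x))) (A - B) + emeasure (density M (\<lambda>x. ennreal (g x))) B
        = emeasure (density M (\<lambda>x. ennreal (g x))) A"
      using BA by (subst plus_emeasure) (auto intro!: arg_cong[of _ _ "emeasure _"])
    finally have "emeasure N A \<le> emeasure (density M (\<lambda>x. ennreal (g x))) A" .
    moreover have "emeasure (density M (\<lambda>x. ennreal (g x))) A \<le> emeasure N A"
      unfolding N[symmetric] by (simp add: emeasure_density g) (auto intro!: nn_integral_mono mult_right_mono)
    ultimately show "emeasure N A = emeasure (density M (\<lambda>x. ennreal (g x))) A" by (rule antisym)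
  qed (use sets in simp)
  ultimately show ?thesis using \<open>g \<in> borel_measurable M\<close> by blast
qed

text \<open>Squaring merges x with -x; this share of the image, coming from x > 0, separates them
  again.\<close>

definition positive_half_square :: "real measure \<Rightarrow> real measure" where
  "positive_half_square M = distr (density M (indicator {0<..})) borel (\<lambda>x. x^2)"

lemma emeasure_positive_half_square:
  assumes [measurable_cong]: "sets M = sets borel" and [measurable]: "A \<in> sets borel"
  shows "emeasure (positive_half_square M) A = emeasure M {x. 0 < x \<and> x^2 \<in> A}"
proof -
  have sp: "space M = UNIV" using assms(1) by (metis sets_eq_imp_space_eq space_borel)
  have "emeasure (positive_half_square M) A = emeasure (density M (indicator {0<..})) ((\<lambda>x. x^2) -` A)"
    unfolding positive_half_square_def by (subst emeasure_distr) (auto simp: sp)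
  also have "\<dots> = (\<integral>\<^sup>+x. indicator {0<..} x * indicator ((\<lambda>x. x^2) -` A) x \<partial>M)"
    using measurable_sets[of "\<lambda>x. x^2" M borel A] by (intro emeasure_density) (auto simp: sp)
  also have "\<dots> = (\<integral>\<^sup>+x. indicator {x. 0 < x \<and> x^2 \<in> A} x \<partial>M)"
    by (intro nn_integral_cong) (auto simp: indicator_def)
  also have "\<dots> = emeasure M {x. 0 < x \<and> x^2 \<in> A}"
    by (rule nn_integral_indicator) measurable
  finally show ?thesis .
qed

text \<open>On positive points the measure is read off from the half image, on the remaining points
  from the full image minus the half image.\<close>

lemma measure_eqI_square:
  assumes sM: "sets M = sets borel" and sN: "sets N = sets borel"
    and "finite_measure M" "finite_measure N"
    and sq: "distr M borel (\<lambda>x. x^2) = distr N borel (\<lambda>x::real. x^2)"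
    and half: "positive_half_square M = positive_half_square N"
  shows "M = N"
proof (rule measure_eqI)
  show "sets M = sets N" using sM sN by simp
  fix B assume "B \<in> sets M"
  then have B [measurable]: "B \<in> sets borel" using sM by simp
  \<comment> \<open>Preimages of \<open>B\<close> under the two branches of the square root; only
    \<open>y = x^2 \<ge> 0\<close> is ever tested.\<close>
  define S where "S = {y. sqrt y \<in> B}"
  define T where "T = {y. - sqrt y \<in> B}"
  have [measurable]: "S \<in> sets borel" "T \<in> sets borel" unfolding S_def T_def by measurable
  have split: "measure L B = measure (positive_half_square L) S
      + (measure (distr L borel (\<lambda>x. x^2)) T - measure (positive_half_square L) T)"
    if sL [measurable_cong]: "sets L = sets borel" and fin: "finite_measure L" for L
  proof -
    interpret finite_measure L by (rule fin)
    have sp: "space L = UNIV" using sL by (metis sets_eq_imp_space_eq space_borel)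
    have h: "measure (positive_half_square L) A = measure L {x. 0 < x \<and> x^2 \<in> A}" if "A \<in> sets borel" for A
      using emeasure_positive_half_square[OF sL that] by (simp add: measure_def)
    have d: "measure (distr L borel (\<lambda>x. x^2)) T = measure L {x. x^2 \<in> T}"
      by (subst measure_distr) (auto simp: sp vimage_def)
    have [measurable]: "{x. 0 < x \<and> x^2 \<in> T} \<in> sets L" "{x. x^2 \<in> T} \<in> sets L" by measurable
    have "measure L {x. x^2 \<in> T} - measure L {x. 0 < x \<and> x^2 \<in> T} = measure L ({x. x^2 \<in> T} - {x. 0 < x \<and> x^2 \<in> T})"
      by (rule finite_measure_Diff[symmetric]) auto
    \<comment> \<open>For \<open>x \<le> 0\<close> the branch \<open>- sqrt (x^2)\<close> returns
      \<open>x\<close>; the point 0 is counted on this side.\<close>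
    also have "{x. x^2 \<in> T} - {x. 0 < x \<and> x^2 \<in> T} = {x. x \<le> 0 \<and> x \<in> B}"
      by (auto simp: T_def)
    finally have neg: "measure L {x. x^2 \<in> T} - measure L {x. 0 < x \<and> x^2 \<in> T} = measure L {x. x \<le> 0 \<and> x \<in> B}" .
    have "{x. 0 < x \<and> x^2 \<in> S} = {x. 0 < x \<and> x \<in> B}" by (auto simp: S_def)
    moreover have "measure L B = measure L {x. 0 < x \<and> x \<in> B} + measure L {x. x \<le> 0 \<and> x \<in> B}"
      by (subst finite_measure_Union[symmetric]) (auto intro!: arg_cong[of _ _ "measure L"])
    ultimately show ?thesis using neg by (simp add: h d)
  qed
  have "measure M B = measure N B"
    using split[OF sM] split[OF sN] sq half assms(3,4) by simp
  then show "emeasure M B = emeasure N B"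
    using assms(3,4) by (simp add: finite_measure.emeasure_eq_measure)
qed

lemma positive_half_square_density:
  assumes sM: "sets M = sets borel" and fin: "finite_measure M"
  shows "\<exists>g :: real \<Rightarrow> real. g \<in> borel_measurable borel \<and> (\<forall>x. 0 \<le> g x \<and> g x \<le> 1)
    \<and> positive_half_square M = density (distr M borel (\<lambda>x. x^2)) (\<lambda>x. ennreal (g x))"
proof -
  note [measurable_cong] = sM
  have sp: "space M = UNIV" using sM by (metis sets_eq_imp_space_eq space_borel)
  have "finite_measure (distr M borel (\<lambda>x. x^2))"
    by (rule finite_measure.finite_measure_distr[OF fin]) measurable
  moreover have "emeasure (positive_half_square M) A \<le> emeasure (distr M borel (\<lambda>x. x^2)) A" if "A \<in> sets borel" for A
  proof -
    note [measurable] = that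
    have "emeasure M {x. 0 < x \<and> x^2 \<in> A} \<le> emeasure M {x. x^2 \<in> A}" by (intro emeasure_mono) auto
    also have "\<dots> = emeasure (distr M borel (\<lambda>x. x^2)) A"
      by (subst emeasure_distr) (auto simp: sp vimage_def)
    finally show ?thesis using emeasure_positive_half_square[OF sM that] by simp
  qed
  moreover have "sets (positive_half_square M) = sets (distr M borel (\<lambda>x. x^2))"
    by (simp add: positive_half_square_def)
  ultimately show ?thesis
    using density_of_dominated_measure[of "distr M borel (\<lambda>x. x^2)" "positive_half_square M"] by auto
qed

text \<open>Integrate x^(2k+1) = 2 * 1_(x>0) |x|^(2k+1) - |x|^(2k+1), where |x|^(2k+1) = (x^2)^k
  sqrt (x^2). Only the first term involves \<open>g\<close>, so for solutions with the same image
  under squaring the odd moments compare the densities.\<close>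

lemma odd_moment_positive_half_square:
  fixes g :: "real \<Rightarrow> real"
  assumes M: "moment_solution s M" and [measurable]: "g \<in> borel_measurable borel" and g: "\<And>x. 0 \<le> g x \<and> g x \<le> 1"
    and dens: "positive_half_square M = density (distr M borel (\<lambda>x. x^2)) (\<lambda>x. ennreal (g x))"
  shows "integrable (distr M borel (\<lambda>x. x^2)) (\<lambda>y. y ^ k * sqrt y)"
    and "integrable (distr M borel (\<lambda>x. x^2)) (\<lambda>y. g y * (y ^ k * sqrt y))"
    and "s (2 * k + 1) = 2 * (\<integral>y. g y * (y ^ k * sqrt y) \<partial>distr M borel (\<lambda>x. x^2))
           - (\<integral>y. y ^ k * sqrt y \<partial>distr M borel (\<lambda>x. x^2))"
proof -
  note D = moment_solutionD[OF M]
  note [measurable_cong] = D(1)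
  let ?h = "\<lambda>y. y ^ k * sqrt y"
  have hsq: "?h (x^2) = \<bar>x ^ (2 * k + 1)\<bar>" for x :: real
    by (simp add: abs_mult power_abs flip: power_mult) (simp add: power_mult)
  have int: "integrable M (\<lambda>x. ?h (x^2))" unfolding hsq using D(3) by (intro integrable_abs)
  show 1: "integrable (distr M borel (\<lambda>x. x^2)) ?h"
    using int by (subst integrable_distr_eq) auto
  show 2: "integrable (distr M borel (\<lambda>x. x^2)) (\<lambda>y. g y * ?h y)"
  proof (rule Bochner_Integration.integrable_bound[OF 1])
    show "AE y in distr M borel (\<lambda>x. x^2). norm (g y * ?h y) \<le> norm (?h y)"
      using g by (intro AE_I2) (auto simp: abs_mult intro!: mult_left_le_one_le)
  qed measurable
  have "(\<integral>y. g y * ?h y \<partial>distr M borel (\<lambda>x. x^2)) = (\<integral>y. ?h y \<partial>positive_half_square M)"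
    unfolding dens using g by (subst integral_density) auto
  also have "\<dots> = (\<integral>x. ?h (x^2) \<partial>density M (\<lambda>x. ennreal (indicator {0<..} x)))"
    unfolding positive_half_square_def by (subst integral_distr) (auto simp: ennreal_indicator)
  also have "\<dots> = (\<integral>x. indicator {0<..} x * ?h (x^2) \<partial>M)"
    by (subst integral_density) auto
  finally have 3: "(\<integral>y. g y * ?h y \<partial>distr M borel (\<lambda>x. x^2)) = (\<integral>x. indicator {0<..} x * ?h (x^2) \<partial>M)" .
  have 4: "(\<integral>y. ?h y \<partial>distr M borel (\<lambda>x. x^2)) = (\<integral>x. ?h (x^2) \<partial>M)"
    by (subst integral_distr) auto
  have int': "integrable M (\<lambda>x. indicator {0<..} x * ?h (x^2))"
    using integrable_mult_indicator[OF _ int, of "{0<..}"] D(1) by simp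
  have "s (2 * k + 1) = (\<integral>x. x ^ (2 * k + 1) \<partial>M)" by (rule D(4)[symmetric])
  also have "\<dots> = (\<integral>x. 2 * (indicator {0<..} x * ?h (x^2)) - ?h (x^2) \<partial>M)"
  proof (rule Bochner_Integration.integral_cong[OF refl])
    fix x :: real
    have "0 \<le> x ^ (2 * k)" by (simp add: zero_le_even_power)
    then show "x ^ (2 * k + 1) = 2 * (indicator {0<..} x * ?h (x^2)) - ?h (x^2)"
      unfolding hsq by (cases "0 < x") (auto simp: abs_mult)
  qed
  also have "\<dots> = 2 * (\<integral>x. indicator {0<..} x * ?h (x^2) \<partial>M) - (\<integral>x. ?h (x^2) \<partial>M)"
    using int int' by simp
  finally show "s (2 * k + 1) = 2 * (\<integral>y. g y * ?h y \<partial>distr M borel (\<lambda>x. x^2)) - (\<integral>y. ?h y \<partial>distr M borel (\<lambda>x. x^2))"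
    unfolding 3 4 .
qed

text \<open>The annihilator has the factor \<open>sqrt y\<close> and says nothing at 0, so the
  densities are compared on \<open>0 < y\<close> only; neither measure charges
  \<open>{..0}\<close>.\<close>

lemma density_eq_if_AE_eq_off_zero:
  assumes sN: "sets P = sets borel" "sets Q = sets borel"
    and P: "P = density M (\<lambda>x. ennreal (g x))" and Q: "Q = density M (\<lambda>x. ennreal (h x))"
    and g [measurable]: "g \<in> borel_measurable M" "h \<in> borel_measurable M"
    and ae: "AE x in M. 0 < x \<longrightarrow> g x = h x"
    and null: "emeasure P {..0::real} = 0" "emeasure Q {..0} = 0"
  shows "P = Q"
proof -
  have sM [measurable_cong]: "sets M = sets borel" using sN P by simp
  show ?thesis
  proof (rule measure_eqI)
    fix A assume "A \<in> sets P"
    then have [measurable]: "A \<in> sets borel" using sN by simp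
    have red: "emeasure L A = emeasure L (A \<inter> {0<..})" if "sets L = sets borel" "emeasure L {..0} = 0" for L
    proof -
      have "AE x in L. x \<notin> {..0}" using that by (intro AE_not_in) (auto simp: null_sets_def)
      then show ?thesis using that by (intro emeasure_eq_AE) auto
    qed
    have "emeasure P (A \<inter> {0<..}) = emeasure Q (A \<inter> {0<..})"
      unfolding P Q using ae
      by (simp add: emeasure_density) (auto intro!: nn_integral_cong_AE simp: indicator_def elim!: eventually_mono)
    then show "emeasure P A = emeasure Q A" using red null sN by simp
  qed (use sN in simp)
qed

lemma indeterminate_double:
  assumes "indeterminate s"
  shows "indeterminate (\<lambda>k. s (k * 2))"
proof -
  obtain M N where MN: "moment_solution s M" "moment_solution s N" "M \<noteq> N"
    using assms unfolding indeterminate_iff_two_solutions by blast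
  note DM = moment_solutionD[OF MN(1)] and DN = moment_solutionD[OF MN(2)]
  define \<mu> where "\<mu> = distr M borel (\<lambda>x. x^2)"
  have solM: "moment_solution (\<lambda>k. s (k * 2)) \<mu>"
    unfolding \<mu>_def by (rule moment_solution_distr_power[OF MN(1)])
  have solN: "moment_solution (\<lambda>k. s (k * 2)) (distr N borel (\<lambda>x. x^2))"
    by (rule moment_solution_distr_power[OF MN(2)])
  show ?thesis
  proof (cases "distr N borel (\<lambda>x. x^2) = \<mu>")
    case False
    then show ?thesis unfolding indeterminate_iff_two_solutions using solM solN by metis
  next
    case True
    have s\<mu> [measurable_cong]: "sets \<mu> = sets borel" by (simp add: \<mu>_def)
    obtain g where g [measurable]: "g \<in> borel_measurable borel" and g01: "\<And>x. 0 \<le> g x \<and> g x \<le> 1"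
      and gd: "positive_half_square M = density \<mu> (\<lambda>x. ennreal (g x))"
      using positive_half_square_density[OF DM(1,2)] unfolding \<mu>_def by blast
    obtain h where h [measurable]: "h \<in> borel_measurable borel" and h01: "\<And>x. 0 \<le> h x \<and> h x \<le> 1"
      and hd: "positive_half_square N = density \<mu> (\<lambda>x. ennreal (h x))"
      using positive_half_square_density[OF DN(1,2)] unfolding True by blast
    note G = odd_moment_positive_half_square[OF MN(1) g g01, folded \<mu>_def, OF gd]
    note H = odd_moment_positive_half_square[OF MN(2) h h01, unfolded True, OF hd]
    define f where "f y = (g y - h y) * sqrt y" for y
    have f [measurable]: "f \<in> borel_measurable borel" unfolding f_def by measurable
    \<comment> \<open>Both formulas for \<open>s (2 * k + 1)\<close> contain the same integral of
      \<open>y ^ k * sqrt y\<close>; subtracting them makes the integrals with \<open>g\<close> and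
      \<open>h\<close> equal.\<close>
    have "(\<integral>y. y ^ k * f y \<partial>\<mu>) = (\<integral>y. g y * (y ^ k * sqrt y) - h y * (y ^ k * sqrt y) \<partial>\<mu>)" for k
      by (intro Bochner_Integration.integral_cong) (auto simp: f_def algebra_simps)
    also have "\<dots> k = 0" for k
      using G(2,3)[of k] H(2,3)[of k] by simp
    finally have zero: "\<And>k. (\<integral>y. y ^ k * f y \<partial>\<mu>) = 0" .
    \<comment> \<open>\<open>g\<close> and \<open>h\<close> differ by at most 1, so f^2 \<le> |y|,
      and \<open>\<mu>\<close> has a first moment.\<close>
    have f2: "integrable \<mu> (\<lambda>y. (f y)^2)"
    proof (rule Bochner_Integration.integrable_bound)
      show "integrable \<mu> (\<lambda>y. y ^ 1)" using moment_solutionD(3)[OF solM] .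
      have "norm ((f y)^2) \<le> norm (y ^ 1)" for y
      proof -
        have "(g y - h y)^2 \<le> 1" using g01[of y] h01[of y] by (simp add: abs_square_le_1 abs_if)
        then have "(g y - h y)^2 * \<bar>y\<bar> \<le> 1 * \<bar>y\<bar>" by (intro mult_right_mono) auto
        moreover have "(sqrt y)^2 = \<bar>y\<bar>" by (simp add: real_sqrt_power[symmetric])
        ultimately show ?thesis by (simp add: f_def power_mult_distrib)
      qed
      then show "AE y in \<mu>. norm ((f y)^2) \<le> norm (y ^ 1)" by simp
    qed measurable
    have "\<not> (AE y in \<mu>. f y = 0)"
    proof
      assume "AE y in \<mu>. f y = 0"
      then have ae: "AE y in \<mu>. 0 < y \<longrightarrow> g y = h y" by eventually_elim (auto simp: f_def)
      have null: "emeasure (positive_half_square L) {..0} = 0" if "sets L = sets borel" for L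
        using that by (subst emeasure_positive_half_square) (auto simp: not_le[symmetric] cong: conj_cong)
      have "positive_half_square M = positive_half_square N"
        by (rule density_eq_if_AE_eq_off_zero[OF _ _ gd hd _ _ ae null[OF DM(1)] null[OF DN(1)]])
           (auto simp: positive_half_square_def)
      then have "M = N"
        using measure_eqI_square[OF DM(1) DN(1) DM(2) DN(2)] True \<mu>_def by simp
      then show False using MN(3) by simp
    qed
    from annihilator_imp_other_solution[OF solM f f2 zero this]
    show ?thesis unfolding indeterminate_iff_two_solutions using solM by metis
  qed
qed

text \<open>Factors 2 are stripped one at a time by doubling; the remaining odd factor is handled by
  a single push-forward.\<close>

lemma indeterminate_multiple:
  assumes "indeterminate s" "d \<ge> 1"
  shows "indeterminate (\<lambda>k. s (k * d))"
  using assms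
proof (induction d arbitrary: s rule: less_induct)
  case (less d)
  show ?case
  proof (cases "odd d")
    case True
    then show ?thesis using less.prems by (intro indeterminate_odd_power)
  next
    case False
    then obtain e where e: "d = e * 2" by (metis evenE mult.commute)
    then have "e < d" "e \<ge> 1" using less.prems by auto
    from less.IH[OF this(1) indeterminate_double[OF less.prems(1)] this(2)]
    show ?thesis by (simp add: e mult.assoc)
  qed
qed

theorem mainTheorem5:
  fixes s :: "nat \<Rightarrow> real" and d l0 :: nat
  assumes "positive_seq s" and "d \<ge> 1" and "even l0"
    and "indeterminate s"
  shows "indeterminate (\<lambda>k. s (k * d + l0))"
  \<comment> \<open>The shift acts on \<open>s\<close> first; replacing the index of the shifted
    sequence by \<open>k * d\<close> then gives \<open>s (k * d + l0)\<close>.\<close>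
  using indeterminate_multiple[OF indeterminate_even_shift[OF assms(4,3)] assms(2)] .

end
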